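(* Let $q$ be an odd prime power, $F=\mathbb{F}_q(t)$, $r\ge4$, $0\ne a\in\mathbb{F}_q[t]$, $f=x_1^2+\cdots+x_r^2$, let $\mathcal{X}$ be the $\mathbb{F}_q[t]$-scheme defined by $f(x_1,\dots,x_r)=a$, and let $X$ be its generic fiber. Then the local measures $m_v^X$ satisfy the following. (1) For any place $v\neq\infty$ with $\deg(p_v)=d$, $$m_v^X(\mathcal{X}(\mathcal{O}_v))=\lim_{l\to\infty}\frac{\#\{x\in(\mathcal{O}_v/p_v^l)^r: f(x)\equiv a \pmod{p_v^l}\}}{q^{ld(r-1)}}.$$ (2) For $v=\infty$, $$m_v^X(X(F_v,q^n))=\lim_{l\to\infty}q^{nr+l}\cdot\mathrm{vol}\big(\{x\in\mathcal{O}_v^r: f(x)\equiv at^{-2n}\pmod{p_v^{2n+l}}\}\big).$$ Moreover, when $k$ is large enough, $$\mathrm{vol}\big(\{x\in\mathcal{O}_v^r: f(x)\equiv at^{-2n}\pmod{p_v^{2n+l}}\}\big)=\frac{\#\{x\in(\mathcal{O}_v/p_v^k)^r: f(x)\equiv at^{-2n}\pmod{p_v^{2n+l}}\}}{q^{kr}}.$$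
   Context: $\infty$ is the place of $F=\mathbb{F}_q(t)$ given by the degree valuation, so $F_\infty=\mathbb{F}_q((t^{-1}))$. For a place $v$, $F_v$ is the completion and $\mathcal{O}_v$ its ring of integers; the uniformizer $p_v$ is the corresponding monic irreducible polynomial if $v\neq\infty$, and $p_\infty=t^{-1}$. Congruences modulo $p_v^j$ mean that the difference lies in $p_v^j\mathcal{O}_v$. $\mathrm{vol}$ is the Haar measure on $F_v^r$ with $\mathrm{vol}(\mathcal{O}_v^r)=1$. $X(F_\infty,q^n)=\{x\in X(F_\infty):|x_i|_\infty\le q^n,\ 1\le i\le r\}$, where $|t|_\infty=q$. The variety $X$ is a homogeneous space of $G=\mathrm{Spin}(f)$, with stabilizer $H\simeq\mathrm{Spin}(h)$ for a quadratic form $h$ of rank $r-1$; as both are semisimple no convergence factors are needed and $m_v^X=|\omega_X|_v$ is the measure on $X(F_v)$ attached to the $G$-invariant gauge form $\omega_X$ (nowhere vanishing regular differential form of top degree) on $X$, where $F_v$ carries the Haar measure giving $\mathcal{O}_v$ volume $1$. Here $\omega_X$ is the form obtained from the fibration $f\colon\mathbb{A}^r_F\to\mathbb{A}^1_F$, namely the restriction to $X=f^{-1}(a)$ of any form $\omega$ with $dx_1\wedge\cdots\wedge dx_r=\omega\wedge df$ (up to sign). *)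

theory Defs
  imports
    "HOL-Analysis.Analysis"
    "HOL-Computational_Algebra.Polynomial_Factorial"
    "HOL-Library.Poly_Mapping"
    "Jordan_Normal_Form.Determinant"
begin

section \<open>Places of the rational function field and completions\<close>

text \<open>A finite field with \<open>q\<close> elements is a type \<open>'k :: {field, finite}\<close> with \<open>q = CARD('k)\<close>; then
  \<open>'k poly\<close> is \<open>F\<^sub>q[t]\<close> and \<open>'k poly fract\<close> is \<open>F = F\<^sub>q(t)\<close>.\<close>

datatype 'p place = Infinite_place | Finite_place 'p

fun is_place :: "'k :: field poly place \<Rightarrow> bool" where
  "is_place Infinite_place \<longleftrightarrow> True"
| "is_place (Finite_place p) \<longleftrightarrow> irreducible p \<and> lead_coeff p = 1"

definition tvar :: "'k :: field poly fract" where
  "tvar = to_fract [:0, 1:]"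

fun uniformizer :: "'k :: field poly place \<Rightarrow> 'k poly fract" where
  "uniformizer Infinite_place = inverse tvar"
| "uniformizer (Finite_place p) = to_fract p"

fun place_degree :: "'k :: field poly place \<Rightarrow> nat" where
  "place_degree Infinite_place = 1"
| "place_degree (Finite_place p) = degree p"

text \<open>The normalised absolute value, on polynomials.\<close>

fun place_abs :: "'k :: {field, finite} poly place \<Rightarrow> 'k poly \<Rightarrow> real" where
  "place_abs Infinite_place P = (if P = 0 then 0 else real CARD('k) ^ degree P)"
| "place_abs (Finite_place p) P =
     (if P = 0 then 0 else inverse (real CARD('k) ^ (degree p * Max {n. p ^ n dvd P})))"

definition abs_dist :: "('f :: field \<Rightarrow> real) \<Rightarrow> 'f \<Rightarrow> 'f \<Rightarrow> real" where
  "abs_dist av x y = av (x - y)"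

definition abs_topology :: "('f :: field \<Rightarrow> real) \<Rightarrow> 'f topology" where
  "abs_topology av = Metric_space.mtopology UNIV (abs_dist av)"

text \<open>\<open>(emb, av)\<close> makes the field \<open>'f\<close> the completion \<open>F\<^sub>v\<close>: a complete valued field in which
  \<open>F\<close>, with its \<open>v\<close>-adic absolute value, is densely embedded.  For \<open>v = \<infinity>\<close> this is
  \<open>F\<^sub>q((t\<^sup>-\<^sup>1))\<close>, up to unique isomorphism.\<close>

locale place_completion =
  fixes v :: "'k :: {field, finite} poly place"
    and emb :: "'k poly fract \<Rightarrow> 'f :: field"
    and av :: "'f \<Rightarrow> real"
  assumes emb_add: "emb (x + y) = emb x + emb y"
    and emb_mult: "emb (x * y) = emb x * emb y"
    and emb_one: "emb 1 = 1"
    and av_nonneg: "0 \<le> av z"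
    and av_eq_0_iff: "av z = 0 \<longleftrightarrow> z = 0"
    and av_mult: "av (z * w) = av z * av w"
    and av_ultrametric: "av (z + w) \<le> max (av z) (av w)"
    and av_emb: "Q \<noteq> 0 \<Longrightarrow> av (emb (Fract P Q)) = place_abs v P / place_abs v Q"
    and dense: "abs_topology av closure_of range emb = UNIV"
    and complete: "Metric_space.mcomplete UNIV (abs_dist av)"

text \<open>\<open>O\<^sub>v\<close>, congruence modulo \<open>p\<^sub>v\<^sup>j\<close> (with \<open>pv\<close> the uniformizer in \<open>F\<^sub>v\<close>), and \<open>O\<^sub>v / p\<^sub>v\<^sup>k\<close>.\<close>

definition integers :: "('f :: field \<Rightarrow> real) \<Rightarrow> 'f set" where
  "integers av = {x. av x \<le> 1}"

definition cong_pow :: "('f :: field \<Rightarrow> real) \<Rightarrow> 'f \<Rightarrow> nat \<Rightarrow> 'f \<Rightarrow> 'f \<Rightarrow> bool" where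
  "cong_pow av pv j x y \<longleftrightarrow> (\<exists>z \<in> integers av. x - y = pv ^ j * z)"

definition residue_classes :: "('f :: field \<Rightarrow> real) \<Rightarrow> 'f \<Rightarrow> nat \<Rightarrow> 'f set set" where
  "residue_classes av pv k =
     integers av // {(x, y). x \<in> integers av \<and> y \<in> integers av \<and> cong_pow av pv k x y}"

section \<open>Affine space over a completion, Haar measure\<close>

text \<open>Points of \<open>F\<^sub>v\<^sup>n\<close> are the functions in \<open>{..<n} \<rightarrow>\<^sub>E UNIV\<close>; coordinates are numbered from 0.\<close>

definition affine_topology :: "('f :: field \<Rightarrow> real) \<Rightarrow> nat \<Rightarrow> (nat \<Rightarrow> 'f) topology" where
  "affine_topology av n = product_topology (\<lambda>_. abs_topology av) {..<n}"

definition integral_points :: "('f :: field \<Rightarrow> real) \<Rightarrow> nat \<Rightarrow> (nat \<Rightarrow> 'f) set" where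
  "integral_points av n = {..<n} \<rightarrow>\<^sub>E integers av"

definition borel_of :: "'a topology \<Rightarrow> 'a measure" where
  "borel_of T = sigma (topspace T) {U. openin T U}"

definition is_haar :: "('f :: field \<Rightarrow> real) \<Rightarrow> nat \<Rightarrow> (nat \<Rightarrow> 'f) measure \<Rightarrow> bool" where
  "is_haar av n \<mu> \<longleftrightarrow>
     sets \<mu> = sets (borel_of (affine_topology av n)) \<and>
     (\<forall>c. \<forall>B \<in> sets \<mu>. emeasure \<mu> ((\<lambda>x. \<lambda>i\<in>{..<n}. x i + c i) ` B) = emeasure \<mu> B) \<and>
     emeasure \<mu> (integral_points av n) = 1"

section \<open>Polynomials in several variables\<close>

type_synonym 'a mpol = "(nat \<Rightarrow>\<^sub>0 nat) \<Rightarrow>\<^sub>0 'a"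

definition mpol_in :: "nat \<Rightarrow> 'a :: zero mpol set" where
  "mpol_in r = {P. \<forall>m \<in> Poly_Mapping.keys P. Poly_Mapping.keys m \<subseteq> {..<r}}"

definition mconst :: "'a :: zero \<Rightarrow> 'a mpol" where
  "mconst c = Poly_Mapping.single 0 c"

definition mvar :: "nat \<Rightarrow> 'a :: zero_neq_one mpol" where
  "mvar i = Poly_Mapping.single (Poly_Mapping.single i 1) 1"

definition mpderiv :: "nat \<Rightarrow> 'a :: comm_semiring_1 mpol \<Rightarrow> 'a mpol" where
  "mpderiv i P = (\<Sum>m \<in> Poly_Mapping.keys P.
     Poly_Mapping.single (m - Poly_Mapping.single i 1)
       (of_nat (Poly_Mapping.lookup m i) * Poly_Mapping.lookup P m))"

definition meval :: "('a :: zero \<Rightarrow> 'b :: comm_semiring_1) \<Rightarrow> 'a mpol \<Rightarrow> (nat \<Rightarrow> 'b) \<Rightarrow> 'b" where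
  "meval emb P x = (\<Sum>m \<in> Poly_Mapping.keys P. emb (Poly_Mapping.lookup P m) *
     (\<Prod>i \<in> Poly_Mapping.keys m. x i ^ Poly_Mapping.lookup m i))"

section \<open>The affine quadric and its gauge form\<close>

definition quad :: "nat \<Rightarrow> (nat \<Rightarrow> 'f :: comm_semiring_1) \<Rightarrow> 'f" where
  "quad r x = (\<Sum>i<r. (x i)\<^sup>2)"

definition quad_poly :: "nat \<Rightarrow> 'a :: comm_semiring_1 mpol" where
  "quad_poly r = quad r mvar"

definition X_points :: "nat \<Rightarrow> 'f :: comm_semiring_1 \<Rightarrow> (nat \<Rightarrow> 'f) set" where
  "X_points r b = {x \<in> {..<r} \<rightarrow>\<^sub>E UNIV. quad r x = b}"

text \<open>
  A family \<open>g 0, \<dots>, g (r-1)\<close> in \<open>F[x]\<close> stands for the form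
  \<open>\<omega> = \<Sum>i<r. g\<^sub>i dx\<^sub>0 \<and> \<dots> (omit dx\<^sub>i) \<dots> \<and> dx\<^sub>r\<^sub>-\<^sub>1\<close>; as \<open>X\<close> is a closed subvariety of affine
  space, every regular \<open>(r-1)\<close>-form on \<open>X\<close> is the restriction of such an \<open>\<omega>\<close>.  Moving \<open>dx\<^sub>i\<close> into place,
  \<open>\<omega> \<and> df = (\<Sum>i<r. (-1)\<^bsup>r-1-i\<^esup> g\<^sub>i \<partial>\<^sub>if) dx\<^sub>0 \<and> \<dots> \<and> dx\<^sub>r\<^sub>-\<^sub>1\<close>.  The definition below
  is the identity \<open>dx\<^sub>0 \<and> \<dots> \<and> dx\<^sub>r\<^sub>-\<^sub>1 = \<plusminus> \<omega> \<and> df\<close> along \<open>X\<close>, that is, modulo \<open>f - a\<close>.  It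
  determines the restriction of \<open>\<omega>\<close> to \<open>X\<close> up to sign.
\<close>

definition gauge_form :: "nat \<Rightarrow> 'a :: field \<Rightarrow> (nat \<Rightarrow> 'a mpol) \<Rightarrow> bool" where
  "gauge_form r b g \<longleftrightarrow>
     (\<forall>i<r. g i \<in> mpol_in r) \<and>
     (\<exists>\<epsilon> \<in> {1, -1}. \<exists>h \<in> mpol_in r.
        (\<Sum>i<r. (-1) ^ (r - 1 - i) * g i * mpderiv i (quad_poly r)) - \<epsilon>
          = h * (quad_poly r - mconst b))"

lemma mpderiv_superset:
  assumes "finite A" "Poly_Mapping.keys P \<subseteq> A"
  shows "mpderiv i P = (\<Sum>m \<in> A.
     Poly_Mapping.single (m - Poly_Mapping.single i 1)
       (of_nat (Poly_Mapping.lookup m i) * Poly_Mapping.lookup P m))"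
  unfolding mpderiv_def
  by (rule sum.mono_neutral_left) (use assms in \<open>auto simp: in_keys_iff\<close>)

lemma mpderiv_add: "mpderiv i (P + Q) = mpderiv i P + mpderiv i Q"
proof -
  let ?A = "Poly_Mapping.keys P \<union> Poly_Mapping.keys Q"
  have "Poly_Mapping.keys (P + Q) \<subseteq> ?A" by (rule Poly_Mapping.keys_add)
  then show ?thesis
    by (simp add: mpderiv_superset[of ?A] lookup_add distrib_left single_add sum.distrib)
qed

lemma mvar_sq: "(mvar j)\<^sup>2 = (Poly_Mapping.single (Poly_Mapping.single j 2) 1 :: 'a :: comm_semiring_1 mpol)"
  unfolding mvar_def power2_eq_square mult_single single_add[symmetric]
  by (simp only: one_add_one mult_1_left)

lemma meval_quad_poly:
  fixes emb :: "'a :: comm_semiring_1 \<Rightarrow> 'b :: comm_semiring_1"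
  assumes "\<And>c d. emb (c + d) = emb c + emb d" "emb 0 = 0" "emb 1 = 1"
  shows "meval emb (quad_poly r) x = quad r x"
proof -
  have sup: "meval emb P x = (\<Sum>m \<in> A. emb (Poly_Mapping.lookup P m) *
       (\<Prod>i \<in> Poly_Mapping.keys m. x i ^ Poly_Mapping.lookup m i))"
    if "finite A" "Poly_Mapping.keys P \<subseteq> A" for A P
    unfolding meval_def
    by (rule sum.mono_neutral_left) (use that assms in \<open>auto simp: in_keys_iff\<close>)
  have add: "meval emb (P + Q) x = meval emb P x + meval emb Q x" for P Q
  proof -
    let ?A = "Poly_Mapping.keys P \<union> Poly_Mapping.keys Q"
    have "Poly_Mapping.keys (P + Q) \<subseteq> ?A" by (rule Poly_Mapping.keys_add)
    then show ?thesis
      by (simp add: sup[of ?A] lookup_add distrib_right sum.distrib assms)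
  qed
  have sq: "meval emb ((mvar j)\<^sup>2) x = (x j)\<^sup>2" for j
    unfolding mvar_sq meval_def by (simp add: assms)
  have "meval emb (\<Sum>j\<in>A. (mvar j)\<^sup>2) x = (\<Sum>j\<in>A. meval emb ((mvar j)\<^sup>2) x)" if "finite A" for A
    using that by (induction A rule: finite_induct) (auto simp: add meval_def[of _ 0])
  then show ?thesis by (simp add: quad_poly_def quad_def sq)
qed

lemma mpderiv_mvar_sq:
  "mpderiv i ((mvar j)\<^sup>2 :: 'a :: comm_ring_1 mpol) = (if i = j then mconst 2 * mvar i else 0)"
proof -
  have "mpderiv i ((mvar j)\<^sup>2 :: 'a mpol) = Poly_Mapping.single (Poly_Mapping.single j 2 - Poly_Mapping.single i 1)
       (of_nat (Poly_Mapping.lookup (Poly_Mapping.single j 2) i))"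
    unfolding mvar_sq mpderiv_def by simp
  also have "\<dots> = (if i = j then mconst 2 * mvar i else 0)"
  proof (cases "i = j")
    case True
    have "Poly_Mapping.single j (2::nat) - Poly_Mapping.single j 1 = Poly_Mapping.single j 1"
      by (simp flip: single_diff)
    moreover have "mconst 2 * mvar j = Poly_Mapping.single (Poly_Mapping.single j 1) (2 :: 'a)"
      unfolding mconst_def mvar_def mult_single by (simp only: add_0 mult_1_right)
    ultimately show ?thesis using True by simp
  qed (simp add: lookup_single)
  finally show ?thesis .
qed

lemma mpderiv_quad_poly:
  assumes "i < r"
  shows "mpderiv i (quad_poly r :: 'a :: comm_ring_1 mpol) = mconst 2 * mvar i"
proof -
  have "mpderiv i (\<Sum>j\<in>A. (mvar j)\<^sup>2 :: 'a mpol) = (\<Sum>j\<in>A. mpderiv i ((mvar j)\<^sup>2))" if "finite A" for A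
    using that by (induction A rule: finite_induct) (auto simp: mpderiv_add mpderiv_def[of _ 0])
  then show ?thesis using assms by (simp add: quad_poly_def quad_def mpderiv_mvar_sq)
qed

lemma gauge_form_exists:
  fixes b :: "'a :: field"
  assumes "b \<noteq> 0" "(2 :: 'a) \<noteq> 0"
  shows "gauge_form r b (\<lambda>i. mconst (1 / (2 * b)) * (-1) ^ (r - 1 - i) * mvar i)"
proof -
  let ?c = "mconst (1 / (2 * b)) :: 'a mpol"
  have mul: "mconst x * mconst y = mconst (x * y)" for x y :: 'a
    by (simp add: mconst_def mult_single)
  have one: "mconst 1 = (1 :: 'a mpol)" by (simp add: mconst_def)
  have mc: "?c * mconst 2 = mconst (1 / b)" using assms by (simp add: mul)
  have sq: "(-1) ^ k * (-1) ^ k = (1 :: 'a mpol)" for k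
    by (simp flip: power_mult_distrib)
  have s: "(\<Sum>i<r. (-1) ^ (r - 1 - i) * (?c * (-1) ^ (r - 1 - i) * mvar i) * mpderiv i (quad_poly r))
      = (\<Sum>i<r. mconst (1 / b) * (mvar i)\<^sup>2)"
  proof (rule sum.cong)
    fix i assume "i \<in> {..<r}"
    then have "mpderiv i (quad_poly r) = (mconst 2 * mvar i :: 'a mpol)" by (simp add: mpderiv_quad_poly)
    then have "(-1) ^ (r - 1 - i) * (?c * (-1) ^ (r - 1 - i) * mvar i) * mpderiv i (quad_poly r)
      = ((-1) ^ (r - 1 - i) * (-1) ^ (r - 1 - i)) * (?c * mconst 2) * (mvar i * mvar i)"
      by (simp only: mult_ac)
    then show "(-1) ^ (r - 1 - i) * (?c * (-1) ^ (r - 1 - i) * mvar i) * mpderiv i (quad_poly r)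
      = mconst (1 / b) * (mvar i)\<^sup>2"
      by (simp only: sq mc power2_eq_square mult_1_left)
  qed simp
  have "(\<Sum>i<r. (-1) ^ (r - 1 - i) * (?c * (-1) ^ (r - 1 - i) * mvar i) * mpderiv i (quad_poly r)) - 1
     = mconst (1 / b) * (quad_poly r - mconst b)"
    unfolding s using assms by (simp add: quad_poly_def quad_def sum_distrib_left right_diff_distrib mul one)
  moreover have "mconst (1 / b) \<in> mpol_in r" by (auto simp: mpol_in_def mconst_def)
  moreover have "?c * (-1) ^ (r - 1 - i) * mvar i \<in> mpol_in r" if "i < r" for i
  proof -
    have "?c * mvar i \<in> mpol_in r" using that 
      by (auto simp: mpol_in_def mconst_def mvar_def mult_single)
    moreover have "(-1) ^ (r - 1 - i) = (1 :: 'a mpol) \<or> (-1) ^ (r - 1 - i) = (-1 :: 'a mpol)"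
      by (metis power_minus1_even neg_one_odd_power neg_one_even_power)
    ultimately show ?thesis by (auto simp: mpol_in_def)
  qed
  ultimately show ?thesis unfolding gauge_form_def by blast
qed

section \<open>The measure attached to a form of top degree\<close>

definition sup_abs :: "('f :: field \<Rightarrow> real) \<Rightarrow> nat \<Rightarrow> (nat \<Rightarrow> 'f) \<Rightarrow> real" where
  "sup_abs av n x = Max ((\<lambda>i. av (x i)) ` {..<n})"

text \<open>\<open>D i j\<close> is the strict partial derivative \<open>\<partial>\<phi>\<^sub>i/\<partial>y\<^sub>j\<close> at \<open>y\<close>.  Strictness (two variable points
  \<open>z\<close>, \<open>w\<close>) is what makes the inverse function theorem and the change of variables formula valid over an
  ultrametric field; it holds for all maps given locally by convergent power series.\<close>

definition strict_deriv ::
  "('f :: field \<Rightarrow> real) \<Rightarrow> nat \<Rightarrow> nat \<Rightarrow> (nat \<Rightarrow> 'f) set \<Rightarrow> ((nat \<Rightarrow> 'f) \<Rightarrow> nat \<Rightarrow> 'f) \<Rightarrow>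
     (nat \<Rightarrow> 'f) \<Rightarrow> (nat \<Rightarrow> nat \<Rightarrow> 'f) \<Rightarrow> bool" where
  "strict_deriv av n r V \<phi> y D \<longleftrightarrow>
     (\<forall>e>0. \<exists>\<delta>>0. \<forall>z\<in>V. \<forall>w\<in>V.
        sup_abs av n (\<lambda>j. z j - y j) < \<delta> \<longrightarrow> sup_abs av n (\<lambda>j. w j - y j) < \<delta> \<longrightarrow>
        sup_abs av r (\<lambda>i. \<phi> z i - \<phi> w i - (\<Sum>j<n. D i j * (z j - w j)))
          \<le> e * sup_abs av n (\<lambda>j. z j - w j))"

text \<open>The minor of the \<open>r \<times> (r-1)\<close> matrix \<open>D\<close> that omits row \<open>i\<close>.\<close>

definition minor :: "nat \<Rightarrow> (nat \<Rightarrow> nat \<Rightarrow> 'f :: comm_ring_1) \<Rightarrow> nat \<Rightarrow> 'f" where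
  "minor r D i =
     Determinant.det (Matrix.mat (r - 1) (r - 1) (\<lambda>(k, j). D (insert_index i k) j))"

text \<open>A local parametrisation \<open>\<phi>\<close>, defined on an open \<open>V \<subseteq> F\<^sub>v\<^sup>r\<^sup>-\<^sup>1\<close>, of the hypersurface
  \<open>X \<subseteq> F\<^sub>v\<^sup>r\<close>, with Jacobian matrix \<open>D y\<close> at \<open>y\<close>; the nonzero minor says that \<open>\<phi>\<close> is an immersion.
  The charts of the analytic manifold \<open>X\<close> are of this kind.\<close>

definition is_chart ::
  "('f :: field \<Rightarrow> real) \<Rightarrow> nat \<Rightarrow> (nat \<Rightarrow> 'f) set \<Rightarrow> (nat \<Rightarrow> 'f) set \<Rightarrow>
     ((nat \<Rightarrow> 'f) \<Rightarrow> nat \<Rightarrow> 'f) \<Rightarrow> ((nat \<Rightarrow> 'f) \<Rightarrow> nat \<Rightarrow> nat \<Rightarrow> 'f) \<Rightarrow> bool" where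
  "is_chart av r X V \<phi> D \<longleftrightarrow>
     openin (affine_topology av (r - 1)) V \<and>
     openin (subtopology (affine_topology av r) X) (\<phi> ` V) \<and>
     homeomorphic_map (subtopology (affine_topology av (r - 1)) V)
       (subtopology (affine_topology av r) (\<phi> ` V)) \<phi> \<and>
     (\<forall>y\<in>V. strict_deriv av (r - 1) r V \<phi> y (D y) \<and> (\<exists>i<r. minor r (D y) i \<noteq> 0))"

text \<open>The coefficient of \<open>dy\<^sub>0 \<and> \<dots> \<and> dy\<^sub>r\<^sub>-\<^sub>2\<close> in \<open>\<phi>\<^sup>*\<omega>\<close> at a point where \<open>\<phi>\<close> has value \<open>x\<close> and
  Jacobian matrix \<open>D\<close>.\<close>

definition pullback ::
  "('a :: zero \<Rightarrow> 'f :: comm_ring_1) \<Rightarrow> nat \<Rightarrow> (nat \<Rightarrow> 'a mpol) \<Rightarrow> (nat \<Rightarrow> 'f) \<Rightarrow>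
     (nat \<Rightarrow> nat \<Rightarrow> 'f) \<Rightarrow> 'f" where
  "pullback emb r g x D = (\<Sum>i<r. meval emb (g i) x * minor r D i)"

text \<open>\<open>m = |\<omega>|\<^sub>v\<close> on the hypersurface \<open>X\<close>: in every chart it is \<open>|\<phi>\<^sup>*\<omega>|\<^sub>v\<close> with respect to the
  normalised Haar measure \<open>\<mu>\<close> of \<open>F\<^sub>v\<^sup>r\<^sup>-\<^sup>1\<close>.  Since countably many charts cover \<open>X\<close>, this
  determines \<open>m\<close>.\<close>

definition is_form_measure ::
  "('a :: zero \<Rightarrow> 'f :: field) \<Rightarrow> ('f \<Rightarrow> real) \<Rightarrow> nat \<Rightarrow> (nat \<Rightarrow> 'f) set \<Rightarrow>
     (nat \<Rightarrow> 'a mpol) \<Rightarrow> (nat \<Rightarrow> 'f) measure \<Rightarrow> (nat \<Rightarrow> 'f) measure \<Rightarrow> bool" where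
  "is_form_measure emb av r X g \<mu> m \<longleftrightarrow>
     sets m = sets (borel_of (subtopology (affine_topology av r) X)) \<and>
     (\<forall>V \<phi> D. is_chart av r X V \<phi> D \<longrightarrow>
        (\<forall>B \<in> sets \<mu>. B \<subseteq> V \<longrightarrow>
           emeasure m (\<phi> ` B)
             = (\<integral>\<^sup>+ y \<in> B. ennreal (av (pullback emb r g (\<phi> y) (D y))) \<partial>\<mu>)))"

section \<open>Points and congruence solutions\<close>

definition X_integral_points ::
  "('f :: field \<Rightarrow> real) \<Rightarrow> nat \<Rightarrow> 'f \<Rightarrow> (nat \<Rightarrow> 'f) set" where
  "X_integral_points av r b = {x \<in> integral_points av r. quad r x = b}"

definition X_bounded_points ::
  "('f :: field \<Rightarrow> real) \<Rightarrow> nat \<Rightarrow> 'f \<Rightarrow> real \<Rightarrow> (nat \<Rightarrow> 'f) set" where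
  "X_bounded_points av r b R = {x \<in> X_points r b. \<forall>i<r. av (x i) \<le> R}"

definition cong_solutions ::
  "('f :: field \<Rightarrow> real) \<Rightarrow> 'f \<Rightarrow> nat \<Rightarrow> nat \<Rightarrow> 'f \<Rightarrow> (nat \<Rightarrow> 'f) set" where
  "cong_solutions av pv r j b = {x \<in> integral_points av r. cong_pow av pv j (quad r x) b}"

text \<open>Solutions of \<open>f(x) \<equiv> b mod p\<^sub>v\<^sup>j\<close> in \<open>(O\<^sub>v / p\<^sub>v\<^sup>k)\<^sup>r\<close>; for \<open>k \<ge> j\<close> the condition does not
  depend on the representative \<open>x\<close> of \<open>\<xi>\<close>.\<close>

definition residue_solutions ::
  "('f :: field \<Rightarrow> real) \<Rightarrow> 'f \<Rightarrow> nat \<Rightarrow> nat \<Rightarrow> nat \<Rightarrow> 'f \<Rightarrow> (nat \<Rightarrow> 'f set) set" where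
  "residue_solutions av pv r k j b =
     {\<xi> \<in> {..<r} \<rightarrow>\<^sub>E residue_classes av pv k.
        \<exists>x. (\<forall>i<r. x i \<in> \<xi> i) \<and> cong_pow av pv j (quad r x) b}"

end

theory Submission
  imports Defs
begin

text \<open>
  Both parts compare the measure of a set of points of the quadric with the volume of the integral
  solutions of \<open>f(x) \<equiv> c\<close> modulo a power \<open>p\<^sup>j\<close> of the uniformizer, where \<open>c = a\<close> at a finite place and
  \<open>c = a t\<^sup>-\<^sup>2\<^sup>n\<close> at infinity; there the substitution \<open>x = t\<^sup>n x'\<close> makes the coordinates integral.  The
  sequences in the statement are in fact eventually constant, and this is shown by cutting both sides
  along the same finitely many small polydiscs.  Write \<open>Q\<close> for the number of elements of the residue field.

  Let \<open>x\<close> be an integral solution of \<open>f(x) = c\<close>, let \<open>x\<^sub>i\<close> be a coordinate of maximal absolute value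
  \<open>\<delta> = Q\<^sup>-\<^sup>s\<close>, and let \<open>C\<close> be the polydisc of radius \<open>Q\<^sup>-\<^sup>K < \<delta>\<close> around \<open>x\<close>.  Since
  \<open>f(y) - f(x) = \<Sum> (y\<^sub>l - x\<^sub>l) (y\<^sub>l + x\<^sub>l)\<close>, the polynomial \<open>f\<close> varies on \<open>C\<close> by at most \<open>Q\<^sup>-\<^sup>K \<delta>\<close>.

  On the measure side, this variation is exactly the range in which Hensel's lemma solves for \<open>x\<^sub>i\<close>, as
  \<open>2\<close> is a unit.  So \<open>X \<inter> C\<close> is a graph over the whole polydisc in the other \<open>r - 1\<close> coordinates
  (\<open>image_param\<close>).  The gauge form pulls back to \<open>1 / (2 x\<^sub>i)\<close> up to sign (\<open>pullback_normal\<close>), whose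
  absolute value is constant on \<open>C\<close>; hence \<open>X \<inter> C\<close> has measure \<open>Q\<^bsup>-K(r-1)\<^esup> / \<delta>\<close>
  (\<open>emeasure_X_polydisc\<close>).

  On the volume side, every point of \<open>C\<close> solves the congruence modulo \<open>p\<^bsup>K+s\<^esup>\<close>, and each further power
  of \<open>p\<close> divides the volume by \<open>Q\<close>, because translations in the \<open>i\<close>-th coordinate permute the lifts of the
  congruence (\<open>measure_congruence_step\<close>).  So \<open>Q\<^sup>j\<close> times the volume of the solutions in \<open>C\<close> is
  \<open>Q\<^bsup>K+s\<^esup> Q\<^bsup>-Kr\<^esup>\<close>, the same number.

  From \<open>\<delta>\<^sup>2 \<ge> \<bar>c\<bar>\<close> one gets a single \<open>K\<close> that works for all points, and by Hensel's lemma again every solution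
  of the congruence lies in one of these polydiscs as soon as \<open>j \<ge> 2K\<close> (\<open>cong_solution_near_point\<close>).
  Summation gives \<open>form_measure_eq_volume\<close>.  The volumes are counts of residue classes by
  \<open>measure_cong_solutions\<close>.
\<close>

section \<open>Non-archimedean absolute values\<close>

locale ultrametric_abs =
  fixes av :: "'f :: field \<Rightarrow> real"
  assumes av_nonneg [simp]: "0 \<le> av z"
    and av_eq_0_iff [simp]: "av z = 0 \<longleftrightarrow> z = 0"
    and av_mult: "av (z * w) = av z * av w"
    and av_ultrametric: "av (z + w) \<le> max (av z) (av w)"
begin

lemma av_0 [simp]: "av 0 = 0"
  by simp

lemma av_pos_iff [simp]: "0 < av z \<longleftrightarrow> z \<noteq> 0"
  using av_nonneg[of z] av_eq_0_iff[of z] by linarith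

lemma av_1 [simp]: "av 1 = 1"
  using av_mult[of 1 1] av_eq_0_iff[of 1] by simp

lemma av_minus [simp]: "av (- z) = av z"
proof -
  have "av (-1) * av (-1) = 1" using av_mult[of "-1" "-1"] by simp
  then have "av (-1) = 1" using av_nonneg[of "-1"] by (metis mult_minus1 square_eq_1_iff neg_0_le_iff_le not_one_le_zero)
  then show ?thesis using av_mult[of "-1" z] by simp
qed

lemma av_commute: "av (z - w) = av (w - z)"
  using av_minus[of "z - w"] by simp

lemma av_power: "av (z ^ k) = av z ^ k"
  by (induction k) (auto simp: av_mult)

lemma av_divide: "av (z / w) = av z / av w"
proof (cases "w = 0")
  case False
  then have "av (z / w) * av w = av z" by (simp flip: av_mult)
  then show ?thesis using False by (simp add: field_simps)
qed simp

lemma av_add_le: "av z \<le> C \<Longrightarrow> av w \<le> C \<Longrightarrow> av (z + w) \<le> C"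
  using av_ultrametric[of z w] by linarith

lemma av_diff_le: "av z \<le> C \<Longrightarrow> av w \<le> C \<Longrightarrow> av (z - w) \<le> C"
  using av_add_le[of z C "- w"] by simp

lemma av_diff_trans: "av (x - y) \<le> C \<Longrightarrow> av (y - z) \<le> C \<Longrightarrow> av (x - z) \<le> C"
  using av_add_le[of "x - y" C "y - z"] by simp

lemma av_sum_le:
  assumes "\<And>i. i \<in> A \<Longrightarrow> av (f i) \<le> C" "0 \<le> C"
  shows "av (\<Sum>i\<in>A. f i) \<le> C"
  using assms by (induction A rule: infinite_finite_induct) (auto intro: av_add_le)

text \<open>Every point of an open disc that misses \<open>0\<close> has the absolute value of the centre.\<close>

lemma av_dominant: "av (x - y) < av y \<Longrightarrow> av x = av y"
  using av_ultrametric[of "x - y" y] av_ultrametric[of "x" "y - x"] av_commute[of x y]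
  by simp

sublocale M: Metric_space UNIV "abs_dist av"
proof
  fix x y z
  show "abs_dist av x z \<le> abs_dist av x y + abs_dist av y z"
    using av_ultrametric[of "x - y" "y - z"] av_nonneg[of "x-y"] av_nonneg[of "y-z"]
    unfolding abs_dist_def by (simp del: av_nonneg)
qed (auto simp: abs_dist_def av_commute)

lemma abs_topology_eq: "abs_topology av = M.mtopology"
  by (simp add: abs_topology_def)

text \<open>The Newton map \<open>z \<mapsto> (w - u\<^sup>2 - z\<^sup>2) / (2 u)\<close> for \<open>(u + z)\<^sup>2 = w\<close> contracts the disc of radius
  \<open>\<rho> < \<bar>u\<bar>\<close>.  Outside that disc it is replaced by its value at \<open>0\<close>, which keeps it a contraction of the
  whole field.\<close>

lemma hensel_sqrt:
  assumes "M.mcomplete" "av 2 = 1" "0 \<le> \<rho>" "\<rho> < av u" "av (w - u\<^sup>2) \<le> \<rho> * av u"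
  obtains x where "x\<^sup>2 = w" "av (x - u) \<le> \<rho>"
proof -
  define N where "N = (\<lambda>z. (w - u\<^sup>2 - (if av z \<le> \<rho> then z\<^sup>2 else 0)) / (2 * u))"
  have u: "u \<noteq> 0" "av u > 0" using assms by auto
  have two: "(2 :: 'f) \<noteq> 0" using assms(2) by (metis av_0 zero_neq_one)
  have avN: "av (a / (2 * u)) = av a / av u" for a
    by (simp add: av_divide av_mult assms(2))
  have Nle: "av (N z) \<le> \<rho>" for z
  proof -
    have "av (z\<^sup>2) \<le> \<rho> * av u" if "av z \<le> \<rho>"
      using that assms(3,4) unfolding power2_eq_square av_mult
      by (intro mult_mono) auto
    then have "av (w - u\<^sup>2 - (if av z \<le> \<rho> then z\<^sup>2 else 0)) \<le> \<rho> * av u"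
      using assms(3,5) u by (intro av_diff_le[OF assms(5)]) simp
    then show ?thesis unfolding N_def avN using u by (simp add: field_simps)
  qed
  define c where "c = \<rho> / av u"
  have lam: "0 \<le> c" "c < 1" using assms u by (auto simp: c_def)
  have diff: "N z - N y = ((if av y \<le> \<rho> then y\<^sup>2 else 0) - (if av z \<le> \<rho> then z\<^sup>2 else 0)) / (2 * u)" for z y
    unfolding N_def by (simp add: diff_divide_distrib)
  have sq: "av (z\<^sup>2) / av u \<le> c * av z" if "av z \<le> \<rho>" for z
    using that u mult_right_mono[of "av z" \<rho> "av z"]
    unfolding c_def power2_eq_square av_mult by (simp add: divide_right_mono)
  have contr: "av (N z - N y) \<le> c * av (z - y)" for z y
  proof -
    consider "av z \<le> \<rho>" "av y \<le> \<rho>" | "av z \<le> \<rho>" "av y > \<rho>" | "av z > \<rho>" "av y \<le> \<rho>" | "av z > \<rho>" "av y > \<rho>"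
      by linarith
    then show ?thesis
    proof cases
      case 1
      have "av (y + z) \<le> \<rho>" using 1 by (intro av_add_le)
      then have "av (y + z) * av (y - z) \<le> \<rho> * av (y - z)" by (intro mult_right_mono) auto
      moreover have "y\<^sup>2 - z\<^sup>2 = (y + z) * (y - z)" by (simp add: power2_eq_square algebra_simps)
      ultimately show ?thesis unfolding diff avN using 1 u
        by (simp add: c_def av_mult av_commute[of z] divide_right_mono)
    next
      case 2
      then have "av (z - y) = av y"
        using av_dominant[of "z - y" "- y"] by simp
      moreover have "c * av z \<le> c * av y" using 2 lam by (intro mult_left_mono) auto
      ultimately show ?thesis unfolding diff avN using 2 sq[of z] by auto
    next
      case 3
      then have "av (z - y) = av z"
        using av_dominant[of "z - y" z] by simp
      moreover have "c * av y \<le> c * av z" using 3 lam by (intro mult_left_mono) auto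
      ultimately show ?thesis unfolding diff avN using 3 sq[of y] by auto
    next
      case 4
      then show ?thesis unfolding diff using lam by simp
    qed
  qed
  obtain z where z: "N z = z"
    by (rule M.Banach_fixedpoint_thm[of N c])
       (use assms(1) lam contr in \<open>auto simp: abs_dist_def\<close>)
  have zr: "av z \<le> \<rho>" using Nle[of z] z by simp
  then have "z * (2 * u) = w - u\<^sup>2 - z\<^sup>2"
    using z u two unfolding N_def by (simp add: divide_eq_eq)
  then have "(u + z)\<^sup>2 = w" by (simp add: power2_eq_square algebra_simps)
  then show ?thesis using that[of "u + z"] zr by simp
qed

subsection \<open>Topology of affine space\<close>

lemma topspace_affine [simp]: "topspace (affine_topology av n) = {..<n} \<rightarrow>\<^sub>E UNIV"
  by (simp add: affine_topology_def abs_topology_eq)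

lemma openin_affine_box:
  assumes "x \<in> {..<n} \<rightarrow>\<^sub>E UNIV"
  shows "openin (affine_topology av n) {y \<in> {..<n} \<rightarrow>\<^sub>E UNIV. \<forall>i<n. av (y i - x i) < e}"
proof -
  have "{y \<in> {..<n} \<rightarrow>\<^sub>E UNIV. \<forall>i<n. av (y i - x i) < e} = (\<Pi>\<^sub>E i\<in>{..<n}. M.mball (x i) e)"
  proof (rule Set.set_eqI)
    fix y
    have "abs_dist av (x i) (y i) = av (y i - x i)" for i
      unfolding abs_dist_def by (rule av_commute)
    then show "y \<in> {y \<in> {..<n} \<rightarrow>\<^sub>E UNIV. \<forall>i<n. av (y i - x i) < e} \<longleftrightarrow>
      y \<in> (\<Pi>\<^sub>E i\<in>{..<n}. M.mball (x i) e)"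
      by (auto simp only: PiE_iff M.in_mball mem_Collect_eq lessThan_iff UNIV_I)
  qed
  also have "openin (affine_topology av n) \<dots>"
    unfolding affine_topology_def abs_topology_eq by (subst openin_PiE) auto
  finally show ?thesis .
qed

lemma openin_affineI:
  assumes "U \<subseteq> {..<n} \<rightarrow>\<^sub>E UNIV"
    and "\<And>x. x \<in> U \<Longrightarrow> \<exists>e>0. \<forall>y \<in> {..<n} \<rightarrow>\<^sub>E UNIV. (\<forall>i<n. av (y i - x i) < e) \<longrightarrow> y \<in> U"
  shows "openin (affine_topology av n) U"
proof (subst openin_subopen, intro ballI)
  fix x assume x: "x \<in> U"
  then obtain e where "e > 0" and e: "\<forall>y \<in> {..<n} \<rightarrow>\<^sub>E UNIV. (\<forall>i<n. av (y i - x i) < e) \<longrightarrow> y \<in> U"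
    using assms(2) by blast
  then show "\<exists>T. openin (affine_topology av n) T \<and> x \<in> T \<and> T \<subseteq> U"
    using openin_affine_box[of x n e] x assms(1)
    by (intro exI[of _ "{y \<in> {..<n} \<rightarrow>\<^sub>E UNIV. \<forall>i<n. av (y i - x i) < e}"]) auto
qed

text \<open>The coordinate projections and the graph maps below do not increase the maximum distance of two
  points, so this crude criterion covers all of them.\<close>

lemma continuous_map_affineI:
  assumes V: "V \<subseteq> {..<n} \<rightarrow>\<^sub>E UNIV" and f: "\<And>x. x \<in> V \<Longrightarrow> f x \<in> {..<m} \<rightarrow>\<^sub>E UNIV"
    and lip: "\<And>x y C i. x \<in> V \<Longrightarrow> y \<in> V \<Longrightarrow> 0 \<le> C \<Longrightarrow> (\<And>j. j < n \<Longrightarrow> av (x j - y j) \<le> C) \<Longrightarrow> i < m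
       \<Longrightarrow> av (f x i - f y i) \<le> C"
  shows "continuous_map (subtopology (affine_topology av n) V) (affine_topology av m) f"
  unfolding affine_topology_def[of _ m] continuous_map_componentwise
proof (intro conjI ballI)
  show "f ` topspace (subtopology (affine_topology av n) V) \<subseteq> extensional {..<m}"
    using f by (auto simp: PiE_def)
next
  fix i assume i: "i \<in> {..<m}"
  show "continuous_map (subtopology (affine_topology av n) V) (abs_topology av) (\<lambda>x. f x i)"
    unfolding abs_topology_eq M.continuous_map_to_metric
  proof (intro ballI allI impI)
    fix x and e :: real assume x: "x \<in> topspace (subtopology (affine_topology av n) V)" and e: "e > 0"
    let ?B = "{y \<in> {..<n} \<rightarrow>\<^sub>E UNIV. \<forall>i<n. av (y i - x i) < e / 2}"
    have "openin (subtopology (affine_topology av n) V) (?B \<inter> V)"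
      using openin_affine_box[of x n "e/2"] x V by (auto simp: openin_subtopology)
    moreover have "av (f x i - f y i) < e" if "y \<in> ?B \<inter> V" for y
    proof -
      have "av (f x i - f y i) \<le> e / 2"
        using that x e i by (subst av_commute, intro lip) (auto intro: less_imp_le)
      then show ?thesis using e by linarith
    qed
    ultimately show "\<exists>U. openin (subtopology (affine_topology av n) V) U \<and> x \<in> U
        \<and> (\<forall>y\<in>U. f y i \<in> M.mball (f x i) e)"
      using x e V by (intro exI[of _ "?B \<inter> V"]) (simp add: abs_dist_def)
  qed
qed

lemma sup_abs_le_iff: "0 < n \<Longrightarrow> sup_abs av n x \<le> C \<longleftrightarrow> (\<forall>i<n. av (x i) \<le> C)"
  unfolding sup_abs_def by (subst Max_le_iff) auto

lemma av_le_sup_abs: "i < n \<Longrightarrow> av (x i) \<le> sup_abs av n x"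
  unfolding sup_abs_def by (intro Max_ge) auto

lemma sup_abs_attained:
  assumes "0 < n"
  obtains i where "i < n" "sup_abs av n x = av (x i)"
proof -
  have "Max ((\<lambda>i. av (x i)) ` {..<n}) \<in> (\<lambda>i. av (x i)) ` {..<n}"
    using assms by (intro Max_in) auto
  then show ?thesis using that unfolding sup_abs_def by auto
qed

lemma sup_abs_nonneg: "0 < n \<Longrightarrow> 0 \<le> sup_abs av n x"
  by (metis sup_abs_attained av_nonneg)

end

lemma sets_borel_of: "sets (borel_of T) = sigma_sets (topspace T) {U. openin T U}"
  unfolding borel_of_def by (rule sets_measure_of) (use openin_subset in blast)

section \<open>Local fields and the volume of congruence sets\<close>

text \<open>A local field whose residue field has \<open>Q\<close> elements and odd characteristic; \<open>p\<close> is a uniformizer and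
  \<open>R\<close> a set of representatives of the residue field.\<close>

locale odd_local_field = ultrametric_abs av for av :: "'f :: field \<Rightarrow> real" +
  fixes p :: 'f and Q :: nat and R :: "'f set"
  assumes complete: "M.mcomplete"
    and av_2: "av 2 = 1"
    and Q_ge_2: "2 \<le> Q"
    and av_p: "av p = 1 / real Q"
    and finite_R: "finite R" and card_R: "card R = Q"
    and R_integral: "c \<in> R \<Longrightarrow> av c \<le> 1"
    and R_exists: "av x \<le> 1 \<Longrightarrow> \<exists>c\<in>R. av (x - c) \<le> av p"
    and R_unique: "c \<in> R \<Longrightarrow> c' \<in> R \<Longrightarrow> av (c - c') \<le> av p \<Longrightarrow> c = c'"
    and av_discrete: "x \<noteq> 0 \<Longrightarrow> \<exists>k::int. av x = av p powi k"
begin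

lemma p_pos: "0 < av p" and p_less_1: "av p < 1"
  using Q_ge_2 by (simp_all add: av_p)

lemma p_nonzero [simp]: "p \<noteq> 0"
  using p_pos by simp

lemma p_pow_mono: "j \<le> k \<Longrightarrow> av p ^ k \<le> av p ^ j"
  using p_pos p_less_1 by (intro power_decreasing) auto

lemma p_pow_less_iff: "av p ^ k < av p ^ j \<longleftrightarrow> j < k"
  using p_pos p_less_1 by (simp add: power_strict_decreasing_iff)

lemma p_pow_pos: "0 < av p ^ k"
  using p_pos by simp

lemma cong_pow_iff: "cong_pow av p j x y \<longleftrightarrow> av (x - y) \<le> av p ^ j"
proof
  assume "cong_pow av p j x y"
  then obtain z where "av z \<le> 1" "x - y = p ^ j * z"
    by (auto simp: cong_pow_def integers_def)
  then show "av (x - y) \<le> av p ^ j"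
    using p_pow_pos[of j] by (simp add: av_mult av_power mult_left_le)
next
  assume "av (x - y) \<le> av p ^ j"
  then have "av ((x - y) / p ^ j) \<le> 1"
    using p_pow_pos[of j] by (simp add: av_divide av_power field_simps)
  then show "cong_pow av p j x y"
    unfolding cong_pow_def integers_def by (intro bexI[of _ "(x - y) / p ^ j"]) auto
qed

text \<open>Only the values of \<open>x\<close> below \<open>n\<close> matter, so the centre can be any function, such as \<open>\<lambda>_. 0\<close>.\<close>

definition polydisc :: "nat \<Rightarrow> nat \<Rightarrow> (nat \<Rightarrow> 'f) \<Rightarrow> (nat \<Rightarrow> 'f) set" where
  "polydisc n k x = {y \<in> {..<n} \<rightarrow>\<^sub>E UNIV. \<forall>i<n. av (y i - x i) \<le> av p ^ k}"

lemma polydisc_subset: "polydisc n k x \<subseteq> {..<n} \<rightarrow>\<^sub>E UNIV"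
  by (auto simp: polydisc_def)

lemma polydisc_self: "x \<in> {..<n} \<rightarrow>\<^sub>E UNIV \<Longrightarrow> x \<in> polydisc n k x"
  using p_pow_pos[of k] by (simp add: polydisc_def)

lemma polydisc_trans: "y \<in> polydisc n k x \<Longrightarrow> polydisc n k y \<subseteq> polydisc n k x"
  unfolding polydisc_def by (blast intro: av_diff_trans)

lemma polydisc_eq: "y \<in> polydisc n k x \<Longrightarrow> polydisc n k y = polydisc n k x"
proof
  assume y: "y \<in> polydisc n k x"
  show "polydisc n k x \<subseteq> polydisc n k y"
  proof
    fix z assume z: "z \<in> polydisc n k x"
    have "av (z i - y i) \<le> av p ^ k" if "i < n" for i
      by (rule av_diff_trans[of _ "x i"]) (use y z that av_commute[of "x i" "y i"] in \<open>auto simp: polydisc_def\<close>)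
    then show "z \<in> polydisc n k y" using z by (simp add: polydisc_def)
  qed
qed (rule polydisc_trans)

lemma polydisc_mono: "k \<le> l \<Longrightarrow> polydisc n l x \<subseteq> polydisc n k x"
  using p_pow_mono[of k l] unfolding polydisc_def by (auto intro: order_trans)

text \<open>Sets defined by congruences are unions of polydiscs of one fixed radius.  This gives their openness,
  hence their measurability.\<close>

lemma openin_stable:
  assumes "U \<subseteq> {..<n} \<rightarrow>\<^sub>E UNIV" "\<And>x. x \<in> U \<Longrightarrow> polydisc n k x \<subseteq> U"
  shows "openin (affine_topology av n) U"
proof (rule openin_affineI[OF assms(1)])
  fix x assume "x \<in> U"
  then have "polydisc n k x \<subseteq> U" by (rule assms(2))
  then show "\<exists>e>0. \<forall>y \<in> {..<n} \<rightarrow>\<^sub>E UNIV. (\<forall>i<n. av (y i - x i) < e) \<longrightarrow> y \<in> U"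
    using p_pow_pos[of k] unfolding polydisc_def by (intro exI[of _ "av p ^ k"]) (auto intro: less_imp_le)
qed

lemma openin_polydisc: "openin (affine_topology av n) (polydisc n k x)"
  by (rule openin_stable[OF polydisc_subset, of _ _ _ k]) (rule polydisc_trans)

lemma integral_points_polydisc: "integral_points av n = polydisc n 0 (\<lambda>_. 0)"
  by (rule Set.set_eqI) (auto simp only: integral_points_def polydisc_def integers_def PiE_iff
    mem_Collect_eq lessThan_iff UNIV_I diff_zero power_0)

text \<open>The next digit of each coordinate: a polydisc consists of \<open>Q\<^sup>n\<close> polydiscs of the next smaller
  radius.\<close>

lemma polydisc_split:
  "polydisc n k x = (\<Union>s \<in> {..<n} \<rightarrow>\<^sub>E R. polydisc n (Suc k) (\<lambda>i. x i + p ^ k * s i))" (is "_ = ?U")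
proof (intro equalityI subsetI)
  fix y assume y: "y \<in> polydisc n k x"
  have "\<exists>c\<in>R. av (y i - (x i + p ^ k * c)) \<le> av p ^ Suc k" if "i < n" for i
  proof -
    have "av ((y i - x i) / p ^ k) \<le> 1"
      using y that p_pow_pos[of k] by (simp add: polydisc_def av_divide av_power)
    then obtain c where c: "c \<in> R" "av ((y i - x i) / p ^ k - c) \<le> av p" using R_exists by blast
    have "y i - (x i + p ^ k * c) = p ^ k * ((y i - x i) / p ^ k - c)" by (simp add: field_simps)
    then show ?thesis using c p_pow_pos[of k] by (intro bexI[of _ c]) (auto simp: av_mult av_power)
  qed
  then obtain s where s: "\<And>i. i < n \<Longrightarrow> s i \<in> R \<and> av (y i - (x i + p ^ k * s i)) \<le> av p ^ Suc k" by metis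
  show "y \<in> ?U"
  proof (rule UN_I)
    show "restrict s {..<n} \<in> {..<n} \<rightarrow>\<^sub>E R" using s by (simp add: restrict_PiE_iff)
    show "y \<in> polydisc n (Suc k) (\<lambda>i. x i + p ^ k * restrict s {..<n} i)"
      using s y by (simp add: polydisc_def)
  qed
next
  fix y assume "y \<in> ?U"
  then obtain s where s: "s \<in> {..<n} \<rightarrow>\<^sub>E R" and y: "y \<in> polydisc n (Suc k) (\<lambda>i. x i + p ^ k * s i)" by blast
  have "av (y i - x i) \<le> av p ^ k" if "i < n" for i
  proof (rule av_diff_trans)
    show "av (y i - (x i + p ^ k * s i)) \<le> av p ^ k"
      using y that p_pow_mono[OF le_SucI[OF order_refl], of k] unfolding polydisc_def
      by (blast intro: order_trans)
    have "av (s i) \<le> 1" using PiE_mem[OF s] that by (simp add: R_integral)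
    then show "av (x i + p ^ k * s i - x i) \<le> av p ^ k"
      using p_pow_pos[of k] by (simp add: av_mult av_power mult_left_le)
  qed
  then show "y \<in> polydisc n k x" using y by (simp add: polydisc_def)
qed

lemma disjoint_polydisc_split:
  "disjoint_family_on (\<lambda>s. polydisc n (Suc k) (\<lambda>i. x i + p ^ k * s i)) ({..<n} \<rightarrow>\<^sub>E R)"
proof (unfold disjoint_family_on_def, intro ballI impI, rule ccontr)
  fix s t assume s: "s \<in> {..<n} \<rightarrow>\<^sub>E R" and t: "t \<in> {..<n} \<rightarrow>\<^sub>E R" and "s \<noteq> t"
    and "polydisc n (Suc k) (\<lambda>i. x i + p ^ k * s i) \<inter> polydisc n (Suc k) (\<lambda>i. x i + p ^ k * t i) \<noteq> {}"
  then obtain y where y: "y \<in> polydisc n (Suc k) (\<lambda>i. x i + p ^ k * s i)"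
     "y \<in> polydisc n (Suc k) (\<lambda>i. x i + p ^ k * t i)" by blast
  have "s i = t i" if "i < n" for i
  proof (rule R_unique)
    show "s i \<in> R" "t i \<in> R" using PiE_mem[OF s] PiE_mem[OF t] that by simp_all
    have "av ((x i + p ^ k * s i) - (x i + p ^ k * t i)) \<le> av p ^ Suc k"
      by (rule av_diff_trans[of _ "y i"])
         (use y that av_commute[of "x i + p ^ k * s i" "y i"] in \<open>auto simp: polydisc_def\<close>)
    then have "av (p ^ k * (s i - t i)) \<le> av p ^ Suc k" by (simp add: algebra_simps)
    then show "av (s i - t i) \<le> av p"
      using p_pow_pos[of k] by (simp add: av_mult av_power)
  qed
  then have "s = t" by (intro PiE_ext[OF s t]) simp
  then show False using \<open>s \<noteq> t\<close> by simp
qed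

text \<open>Expansions with \<open>k\<close> digits from \<open>R\<close>.\<close>

lemma finite_representatives:
  "\<exists>F. finite F \<and> (\<forall>x. av x \<le> 1 \<longrightarrow> (\<exists>c\<in>F. av (x - c) \<le> av p ^ k))"
proof (induction k)
  case 0
  show ?case by (intro exI[of _ "{0}"]) auto
next
  case (Suc k)
  then obtain F where F: "finite F" "\<And>x. av x \<le> 1 \<Longrightarrow> \<exists>c\<in>F. av (x - c) \<le> av p ^ k" by blast
  have "\<exists>d\<in>(\<lambda>(c, c'). c + p * c') ` (R \<times> F). av (x - d) \<le> av p ^ Suc k" if "av x \<le> 1" for x
  proof -
    obtain c where c: "c \<in> R" "av (x - c) \<le> av p" using R_exists[OF \<open>av x \<le> 1\<close>] by blast
    then have "av ((x - c) / p) \<le> 1" using p_pos by (simp add: av_divide)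
    then obtain c' where c': "c' \<in> F" "av ((x - c) / p - c') \<le> av p ^ k" using F by blast
    have "x - (c + p * c') = p * ((x - c) / p - c')" by (simp add: field_simps)
    then have "av (x - (c + p * c')) \<le> av p ^ Suc k"
      using c' p_pos by (simp add: av_mult)
    then show ?thesis using c c' by force
  qed
  then show ?case using F(1) finite_R by (intro exI[of _ "(\<lambda>(c, c'). c + p * c') ` (R \<times> F)"]) auto
qed

subsection \<open>Haar measure\<close>

context
  fixes n :: nat and \<mu> :: "(nat \<Rightarrow> 'f) measure"
  assumes haar: "is_haar av n \<mu>"
begin

lemma haar_sets_open: "openin (affine_topology av n) U \<Longrightarrow> U \<in> sets \<mu>"
  using haar by (auto simp: is_haar_def sets_borel_of)

lemma haar_sets_stable:
  assumes "U \<subseteq> {..<n} \<rightarrow>\<^sub>E UNIV" "\<And>x. x \<in> U \<Longrightarrow> polydisc n k x \<subseteq> U"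
  shows "U \<in> sets \<mu>"
  by (rule haar_sets_open[OF openin_stable[OF assms]])

lemma haar_sets_polydisc: "polydisc n k x \<in> sets \<mu>"
  by (rule haar_sets_open[OF openin_polydisc])

lemma haar_translate:
  "B \<in> sets \<mu> \<Longrightarrow> emeasure \<mu> ((\<lambda>x. \<lambda>i\<in>{..<n}. x i + c i) ` B) = emeasure \<mu> B"
  using haar by (simp add: is_haar_def)

lemma haar_polydisc_center: "emeasure \<mu> (polydisc n k x) = emeasure \<mu> (polydisc n k (\<lambda>_. 0))"
proof -
  have "polydisc n k x = (\<lambda>y. \<lambda>i\<in>{..<n}. y i + x i) ` polydisc n k (\<lambda>_. 0)"
  proof (intro equalityI subsetI)
    fix y assume y: "y \<in> polydisc n k x"
    show "y \<in> (\<lambda>y. \<lambda>i\<in>{..<n}. y i + x i) ` polydisc n k (\<lambda>_. 0)"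
    proof (rule image_eqI)
      show "(\<lambda>i\<in>{..<n}. y i - x i) \<in> polydisc n k (\<lambda>_. 0)"
        using y by (simp add: polydisc_def)
      show "y = (\<lambda>i\<in>{..<n}. (\<lambda>i\<in>{..<n}. y i - x i) i + x i)"
        using y by (intro PiE_ext[of y "{..<n}" "\<lambda>_. UNIV"]) (simp_all add: polydisc_def)
    qed
  next
    fix y assume "y \<in> (\<lambda>y. \<lambda>i\<in>{..<n}. y i + x i) ` polydisc n k (\<lambda>_. 0)"
    then show "y \<in> polydisc n k x" by (clarsimp simp: polydisc_def)
  qed
  then show ?thesis by (simp add: haar_translate haar_sets_polydisc)
qed

lemma haar_integral_points: "emeasure \<mu> (polydisc n 0 x) = 1"
  using haar by (simp add: haar_polydisc_center[of 0 x] is_haar_def integral_points_polydisc)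

lemma haar_finite: "B \<subseteq> polydisc n k x \<Longrightarrow> emeasure \<mu> B \<noteq> \<infinity>"
proof -
  assume "B \<subseteq> polydisc n k x"
  then have "emeasure \<mu> B \<le> emeasure \<mu> (polydisc n 0 x)"
    using polydisc_mono[of 0 k n x] by (intro emeasure_mono haar_sets_polydisc) auto
  then show ?thesis by (auto simp: haar_integral_points top_unique)
qed

text \<open>The \<open>Q\<^sup>n\<close> parts of a polydisc are translates of each other, and the integral points have volume
  \<open>1\<close>.\<close>

lemma haar_measure_polydisc: "measure \<mu> (polydisc n k x) = 1 / real Q ^ (k * n)"
proof (induction k arbitrary: x)
  case 0
  then show ?case by (simp add: measure_def haar_integral_points)
next
  case (Suc k)
  have center: "measure \<mu> (polydisc n (Suc k) y) = measure \<mu> (polydisc n (Suc k) x)" for y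
    unfolding measure_def by (simp add: haar_polydisc_center[of "Suc k" x] haar_polydisc_center[of "Suc k" y])
  have fin: "finite ({..<n} \<rightarrow>\<^sub>E R)" using finite_R by (intro finite_PiE) simp_all
  have sets: "(\<lambda>s. polydisc n (Suc k) (\<lambda>i. x i + p ^ k * s i)) ` ({..<n} \<rightarrow>\<^sub>E R) \<subseteq> sets \<mu>"
    by (rule image_subsetI, rule haar_sets_polydisc)
  have finite_measure: "emeasure \<mu> (polydisc n (Suc k) (\<lambda>i. x i + p ^ k * s i)) \<noteq> \<infinity>" for s
    by (rule haar_finite[OF subset_refl])
  have "1 / real Q ^ (k * n) = measure \<mu> (polydisc n k x)" by (simp add: Suc)
  also have "\<dots> = (\<Sum>s \<in> {..<n} \<rightarrow>\<^sub>E R. measure \<mu> (polydisc n (Suc k) (\<lambda>i. x i + p ^ k * s i)))"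
    unfolding polydisc_split[of n k x]
    by (rule measure_finite_Union[OF fin sets disjoint_polydisc_split finite_measure])
  also have "\<dots> = (\<Sum>s \<in> {..<n} \<rightarrow>\<^sub>E R. measure \<mu> (polydisc n (Suc k) x))"
    by (intro sum.cong refl center)
  also have "\<dots> = real Q ^ n * measure \<mu> (polydisc n (Suc k) x)"
    by (simp add: card_PiE card_R)
  finally show ?case using Q_ge_2 by (simp add: field_simps power_add)
qed

end

lemma quad_shift: "i < r \<Longrightarrow> quad r (x(i := x i + z)) = quad r x + 2 * x i * z + z\<^sup>2" for x :: "nat \<Rightarrow> 'f"
  unfolding quad_def by (simp add: sum.remove[of "{..<r}" i] power2_eq_square algebra_simps)

lemma quad_diff: "quad r x - quad r y = (\<Sum>i<r. (x i - y i) * (x i + y i))" for x y :: "nat \<Rightarrow> 'f"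
  unfolding quad_def by (simp add: sum_subtractf[symmetric] power2_eq_square algebra_simps)

text \<open>The factor \<open>\<delta>\<close> is what makes Hensel's lemma applicable on a full polydisc: it bounds
  \<open>x\<^sub>i + y\<^sub>i = (x\<^sub>i - y\<^sub>i) + 2 y\<^sub>i\<close>.\<close>

lemma quad_close:
  assumes "\<And>i. i < r \<Longrightarrow> av (x i - y i) \<le> \<rho>" "\<And>i. i < r \<Longrightarrow> av (y i) \<le> \<delta>" "0 \<le> \<rho>" "\<rho> \<le> \<delta>"
  shows "av (quad r x - quad r y) \<le> \<rho> * \<delta>"
  unfolding quad_diff
proof (rule av_sum_le)
  fix i assume "i \<in> {..<r}"
  then have i: "i < r" by simp
  have "2 * y i = y i + y i" by simp
  then have "av (2 * y i) \<le> \<delta>" using assms(2)[OF i] by (simp only: av_add_le)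
  then have "av ((x i - y i) + 2 * y i) \<le> \<delta>"
    using assms(1)[OF i] assms(4) by (intro av_add_le) auto
  then have "av (x i + y i) \<le> \<delta>" by (simp add: algebra_simps)
  then show "av ((x i - y i) * (x i + y i)) \<le> \<rho> * \<delta>"
    using assms(1)[OF i] assms(3) by (auto simp: av_mult intro: mult_mono)
qed (use assms in auto)

lemma quad_congruent:
  assumes "x \<in> polydisc r k y" "\<And>i. i < r \<Longrightarrow> av (y i) \<le> 1"
  shows "av (quad r x - quad r y) \<le> av p ^ k"
  using quad_close[of r x y "av p ^ k" 1] assms p_pow_pos[of k] p_pow_mono[of 0 k] by (simp add: polydisc_def)

text \<open>Translation in the \<open>i\<close>-th coordinate moves \<open>f\<close> by \<open>2 x\<^sub>i \<zeta> + \<zeta>\<^sup>2\<close>; on a polydisc of radius smaller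
  than \<open>\<bar>x\<^sub>i\<bar>\<close> this is constant to first order.  So the \<open>Q\<close> lifts of a congruence from modulus \<open>p\<^sup>j\<close> to
  \<open>p\<^sup>j\<^sup>+\<^sup>1\<close> have solution sets that are translates of each other.\<close>

lemma measure_congruence_step:
  fixes x :: "nat \<Rightarrow> 'f"
  assumes haar: "is_haar av r \<mu>" and int: "\<And>l. l < r \<Longrightarrow> av (x l) \<le> 1"
    and i: "i < r" and s: "av (x i) = av p ^ s" "s < K" and j: "K + s \<le> j"
  defines "A \<equiv> \<lambda>j c. {y \<in> polydisc r K x. av (quad r y - c) \<le> av p ^ j}"
  shows "measure \<mu> (A j c) = real Q * measure \<mu> (A (Suc j) c)"
proof -
  have xi: "x i \<noteq> 0" using s(1) p_pow_pos[of s] by auto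
  have two: "(2 :: 'f) \<noteq> 0" using av_2 by auto
  have A_sub: "A j c \<subseteq> polydisc r K x" for j c by (auto simp: A_def)
  have A_sets: "A j c \<in> sets \<mu>" for j c
  proof (rule haar_sets_stable[OF haar])
    show "A j c \<subseteq> {..<r} \<rightarrow>\<^sub>E UNIV" using A_sub polydisc_subset by blast
  next
    fix y assume y: "y \<in> A j c"
    have y_int: "av (y l) \<le> 1" if "l < r" for l
    proof -
      have "av (y l - x l) \<le> 1"
        using y that p_pow_mono[of 0 K] by (force simp: A_def polydisc_def)
      then show ?thesis using av_add_le[of "y l - x l" 1 "x l"] int[OF that] by simp
    qed
    show "polydisc r (K + j) y \<subseteq> A j c"
    proof
      fix z assume z: "z \<in> polydisc r (K + j) y"
      have "z \<in> polydisc r K x"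
        using z polydisc_mono[OF le_add1] polydisc_trans[OF subsetD[OF A_sub y]] by blast
      moreover have "av (quad r z - quad r y) \<le> av p ^ (K + j)"
        using z y_int by (rule quad_congruent)
      ultimately show "z \<in> A j c"
        using y p_pow_mono[of j "K + j"] av_diff_trans[of "quad r z" "quad r y" "av p ^ j" c]
        unfolding A_def by simp
    qed
  qed
  \<comment> \<open>Solving \<open>2 x\<^sub>i \<zeta> = p\<^sup>j w\<close>; the assumptions on \<open>j\<close> and \<open>K\<close> keep \<open>\<zeta>\<close> inside the polydisc and make the
    errors \<open>2 (y\<^sub>i - x\<^sub>i) \<zeta>\<close> and \<open>\<zeta>\<^sup>2\<close> vanish modulo \<open>p\<^sup>j\<^sup>+\<^sup>1\<close>.\<close>
  have shift: "emeasure \<mu> (A (Suc j) (c + p ^ j * w)) = emeasure \<mu> (A (Suc j) c)" if w: "av w \<le> 1" for w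
  proof -
    define \<zeta> where "\<zeta> = p ^ j * w / (2 * x i)"
    have "av \<zeta> * av p ^ s = av p ^ j * av w" using s(1) xi p_pos by (simp add: \<zeta>_def av_divide av_mult av_power av_2)
    then have "av \<zeta> * av p ^ s \<le> av p ^ (j - s) * av p ^ s"
      using w j p_pow_pos[of j] by (simp flip: power_add add: mult_left_le)
    then have \<zeta>: "av \<zeta> \<le> av p ^ (j - s)" using p_pow_pos[of s] by simp
    have \<zeta>K: "av \<zeta> \<le> av p ^ K" using \<zeta> p_pow_mono[of K "j - s"] j by linarith
    have move: "y(i := y i + z) \<in> A (Suc j) (d + 2 * x i * z)" if y: "y \<in> A (Suc j) d" and z: "z = \<zeta> \<or> z = - \<zeta>" for y z d
    proof -
      have zK: "av z \<le> av p ^ K" and zj: "av z \<le> av p ^ (j - s)" using z \<zeta> \<zeta>K by auto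
      have yx: "av (y l - x l) \<le> av p ^ K" if "l < r" for l using y that by (simp add: A_def polydisc_def)
      have "av (y i + z - x i) \<le> av p ^ K" using av_add_le[OF yx[OF i] zK] by (simp add: algebra_simps)
      moreover have "y(i := y i + z) \<in> {..<r} \<rightarrow>\<^sub>E UNIV"
        using PiE_arb[OF subsetD[OF polydisc_subset subsetD[OF A_sub y]]] i by (intro PiE_I) simp_all
      ultimately have disc: "y(i := y i + z) \<in> polydisc r K x"
        using yx i by (simp add: polydisc_def)
      have "av (2 * (y i - x i) * z) \<le> av p ^ K * av p ^ (j - s)"
        using yx[OF i] zj unfolding av_mult av_2 by (intro mult_mono) simp_all
      also have "\<dots> \<le> av p ^ Suc j"
        unfolding power_add[symmetric] using s(2) j by (intro p_pow_mono) linarith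
      finally have 1: "av (2 * (y i - x i) * z) \<le> av p ^ Suc j" .
      have "av (z\<^sup>2) \<le> av p ^ (j - s) * av p ^ (j - s)"
        using zj unfolding power2_eq_square av_mult by (intro mult_mono) auto
      also have "\<dots> \<le> av p ^ Suc j"
        unfolding power_add[symmetric] using s(2) j by (intro p_pow_mono) linarith
      finally have 2: "av (z\<^sup>2) \<le> av p ^ Suc j" .
      have "quad r (y(i := y i + z)) - (d + 2 * x i * z) = (quad r y - d) + (2 * (y i - x i) * z + z\<^sup>2)"
        unfolding quad_shift[OF i] by (simp add: algebra_simps)
      moreover have "av (quad r y - d) \<le> av p ^ Suc j" using y by (simp add: A_def)
      ultimately have "av (quad r (y(i := y i + z)) - (d + 2 * x i * z)) \<le> av p ^ Suc j"
        using 1 2 by (simp only: av_add_le)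
      then show ?thesis using disc by (simp add: A_def)
    qed
    have z2: "2 * x i * \<zeta> = p ^ j * w" using xi two by (simp add: \<zeta>_def)
    define sh where "sh = (\<lambda>l. if l = i then \<zeta> else 0)"
    have sh_eq: "(\<lambda>l\<in>{..<r}. y l + sh l) = y(i := y i + \<zeta>)" if "y \<in> {..<r} \<rightarrow>\<^sub>E UNIV" for y
    proof
      show "(\<lambda>l\<in>{..<r}. y l + sh l) l = (y(i := y i + \<zeta>)) l" for l
        using PiE_arb[OF that, of l] i by (cases "l < r") (auto simp: sh_def)
    qed
    have "(\<lambda>y. \<lambda>l\<in>{..<r}. y l + sh l) ` A (Suc j) c = (\<lambda>y. y(i := y i + \<zeta>)) ` A (Suc j) c"
      by (rule image_cong[OF refl], rule sh_eq, rule subsetD[OF polydisc_subset], erule subsetD[OF A_sub])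
    also have "\<dots> = A (Suc j) (c + p ^ j * w)"
    proof (intro equalityI subsetI)
      fix y assume "y \<in> (\<lambda>y. y(i := y i + \<zeta>)) ` A (Suc j) c"
      then show "y \<in> A (Suc j) (c + p ^ j * w)" using move[of _ c \<zeta>] z2 by auto
    next
      fix y assume y: "y \<in> A (Suc j) (c + p ^ j * w)"
      have "y(i := y i + - \<zeta>) \<in> A (Suc j) (c + p ^ j * w + 2 * x i * (- \<zeta>))"
        by (rule move[OF y]) simp
      then have "y(i := y i - \<zeta>) \<in> A (Suc j) c" using z2 by simp
      then show "y \<in> (\<lambda>y. y(i := y i + \<zeta>)) ` A (Suc j) c"
        by (intro image_eqI[where x = "y(i := y i - \<zeta>)"]) simp_all
    qed
    finally show ?thesis using haar_translate[OF haar A_sets, of sh "Suc j" c] by simp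
  qed
  have split: "A j c = (\<Union>w\<in>R. A (Suc j) (c + p ^ j * w))"
  proof (intro equalityI subsetI)
    fix y assume y: "y \<in> A j c"
    then have "av ((quad r y - c) / p ^ j) \<le> 1"
      using p_pow_pos[of j] by (simp add: A_def av_divide av_power)
    then obtain w where w: "w \<in> R" "av ((quad r y - c) / p ^ j - w) \<le> av p" using R_exists by blast
    have "quad r y - (c + p ^ j * w) = p ^ j * ((quad r y - c) / p ^ j - w)" by (simp add: field_simps)
    then have "av (quad r y - (c + p ^ j * w)) \<le> av p ^ Suc j"
      using w p_pow_pos[of j] by (simp add: av_mult av_power)
    then show "y \<in> (\<Union>w\<in>R. A (Suc j) (c + p ^ j * w))" using w y by (auto simp: A_def)
  next
    fix y assume "y \<in> (\<Union>w\<in>R. A (Suc j) (c + p ^ j * w))"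
    then obtain w where w: "w \<in> R" "y \<in> A (Suc j) (c + p ^ j * w)" by blast
    have "av (quad r y - c) \<le> av p ^ j"
    proof (rule av_diff_trans)
      show "av (quad r y - (c + p ^ j * w)) \<le> av p ^ j"
        using w(2) p_pow_mono[OF le_SucI[OF order_refl], of j] unfolding A_def by (blast intro: order_trans)
      show "av (c + p ^ j * w - c) \<le> av p ^ j"
        using R_integral[OF w(1)] p_pow_pos[of j] by (simp add: av_mult av_power mult_left_le)
    qed
    then show "y \<in> A j c" using w(2) by (simp add: A_def)
  qed
  have disj: "disjoint_family_on (\<lambda>w. A (Suc j) (c + p ^ j * w)) R"
  proof (unfold disjoint_family_on_def, intro ballI impI, rule ccontr)
    fix w w' assume w: "w \<in> R" "w' \<in> R" "w \<noteq> w'"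
      and "A (Suc j) (c + p ^ j * w) \<inter> A (Suc j) (c + p ^ j * w') \<noteq> {}"
    then obtain y where y: "y \<in> A (Suc j) (c + p ^ j * w)" "y \<in> A (Suc j) (c + p ^ j * w')" by blast
    have "av ((c + p ^ j * w) - (c + p ^ j * w')) \<le> av p ^ Suc j"
      by (rule av_diff_trans[of _ "quad r y"])
         (use y in \<open>simp_all add: A_def av_commute[of "c + p ^ j * w" "quad r y"]\<close>)
    then have "av (p ^ j * (w - w')) \<le> av p ^ Suc j" by (simp add: algebra_simps)
    then have "av (w - w') \<le> av p"
      using p_pow_pos[of j] by (simp add: av_mult av_power)
    then show False using R_unique w by blast
  qed
  have sets: "(\<lambda>w. A (Suc j) (c + p ^ j * w)) ` R \<subseteq> sets \<mu>"
    by (rule image_subsetI, rule A_sets)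
  have "measure \<mu> (A j c) = (\<Sum>w\<in>R. measure \<mu> (A (Suc j) (c + p ^ j * w)))"
    unfolding split
    by (rule measure_finite_Union[OF finite_R sets disj haar_finite[OF haar A_sub]])
  also have "\<dots> = (\<Sum>w\<in>R. measure \<mu> (A (Suc j) c))"
    by (intro sum.cong refl) (simp add: measure_def shift R_integral)
  finally show ?thesis by (simp add: card_R)
qed

end

context odd_local_field
begin

subsection \<open>Counting residue classes\<close>

lemma residue_classes_eq:
  "residue_classes av p k = (\<lambda>x. {y. av (y - x) \<le> av p ^ k}) ` integers av"
proof -
  have "{(x, y). x \<in> integers av \<and> y \<in> integers av \<and> cong_pow av p k x y} `` {x} = {y. av (y - x) \<le> av p ^ k}"
    if "x \<in> integers av" for x
  proof -
    have "av y \<le> 1" if "av (y - x) \<le> av p ^ k" for y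
      using av_add_le[of "y - x" 1 x] that \<open>x \<in> integers av\<close> p_pow_mono[of 0 k] by (simp add: integers_def)
    then show ?thesis using that by (auto simp: cong_pow_iff integers_def av_commute[of x])
  qed
  then show ?thesis unfolding residue_classes_def quotient_def by auto
qed

lemma finite_residue_classes: "finite (residue_classes av p k)"
proof -
  obtain F where F: "finite F" "\<And>x. av x \<le> 1 \<Longrightarrow> \<exists>c\<in>F. av (x - c) \<le> av p ^ k"
    using finite_representatives by blast
  have "residue_classes av p k \<subseteq> (\<lambda>x. {y. av (y - x) \<le> av p ^ k}) ` F"
    unfolding residue_classes_eq
  proof
    fix \<xi> assume "\<xi> \<in> (\<lambda>x. {y. av (y - x) \<le> av p ^ k}) ` integers av"
    then obtain x where x: "av x \<le> 1" "\<xi> = {y. av (y - x) \<le> av p ^ k}" by (auto simp: integers_def)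
    then obtain c where c: "c \<in> F" "av (x - c) \<le> av p ^ k" using F by blast
    then have "\<xi> = {y. av (y - c) \<le> av p ^ k}"
      using av_diff_trans[of _ x "av p ^ k" c] av_diff_trans[of _ c "av p ^ k" x] x(2) by (auto simp: av_commute[of c])
    then show "\<xi> \<in> (\<lambda>x. {y. av (y - x) \<le> av p ^ k}) ` F" using c by blast
  qed
  then show ?thesis using F(1) finite_surj by blast
qed

lemma residue_class_member:
  assumes "\<xi> \<in> residue_classes av p k" "x \<in> \<xi>"
  shows "\<xi> = {y. av (y - x) \<le> av p ^ k}" "av x \<le> 1"
proof -
  obtain z where z: "av z \<le> 1" "\<xi> = {y. av (y - z) \<le> av p ^ k}"
    using assms(1) by (auto simp: residue_classes_eq integers_def)
  then show "\<xi> = {y. av (y - x) \<le> av p ^ k}"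
    using assms(2) av_diff_trans[of _ x "av p ^ k" z] av_diff_trans[of _ z "av p ^ k" x]
    by (auto simp: av_commute[of z])
  show "av x \<le> 1"
    using z assms(2) av_add_le[of "x - z" 1 z] p_pow_mono[of 0 k] by simp
qed

lemma cong_solutions_eq:
  "cong_solutions av p r j c = {x \<in> polydisc r 0 (\<lambda>_. 0). av (quad r x - c) \<le> av p ^ j}"
  by (simp add: cong_solutions_def cong_pow_iff integral_points_polydisc)

lemma integral_polydisc: "x \<in> polydisc r 0 (\<lambda>_. 0) \<longleftrightarrow> x \<in> {..<r} \<rightarrow>\<^sub>E UNIV \<and> (\<forall>i<r. av (x i) \<le> 1)"
  by (simp add: polydisc_def)

lemma polydisc_subset_cong_solutions:
  assumes "x \<in> cong_solutions av p r j c" "j \<le> k"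
  shows "polydisc r k x \<subseteq> cong_solutions av p r j c"
proof
  fix y assume y: "y \<in> polydisc r k x"
  have x: "x \<in> polydisc r 0 (\<lambda>_. 0)" "av (quad r x - c) \<le> av p ^ j"
    using assms(1) by (auto simp: cong_solutions_eq)
  have "y \<in> polydisc r 0 (\<lambda>_. 0)"
    using y polydisc_mono[of 0 k r x] polydisc_trans[OF x(1)] by blast
  moreover have "av (quad r y - quad r x) \<le> av p ^ k"
    using y x(1) by (intro quad_congruent) (simp_all add: integral_polydisc)
  then have "av (quad r y - c) \<le> av p ^ j"
    by (rule av_diff_trans[OF order_trans[OF _ p_pow_mono[OF assms(2)]] x(2)])
  ultimately show "y \<in> cong_solutions av p r j c" by (simp add: cong_solutions_eq)
qed

lemma residue_solution_polydisc:
  assumes "\<xi> \<in> residue_solutions av p r k j c" "j \<le> k"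
  obtains x where "x \<in> cong_solutions av p r j c" "Pi\<^sub>E {..<r} \<xi> = polydisc r k x"
proof -
  obtain x where \<xi>: "\<xi> \<in> {..<r} \<rightarrow>\<^sub>E residue_classes av p k"
    and x: "\<And>i. i < r \<Longrightarrow> x i \<in> \<xi> i" and q: "cong_pow av p j (quad r x) c"
    using assms(1) by (auto simp: residue_solutions_def)
  define y where "y = restrict x {..<r}"
  have cls: "\<xi> i = {z. av (z - y i) \<le> av p ^ k}" "av (y i) \<le> 1" if "i < r" for i
    using residue_class_member[OF PiE_mem[OF \<xi>] x, of i] that by (simp_all add: y_def)
  have "quad r y = quad r x" by (simp add: quad_def y_def)
  then have "y \<in> cong_solutions av p r j c"
    using q cls(2) by (simp add: cong_solutions_eq cong_pow_iff integral_polydisc y_def)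
  moreover have "Pi\<^sub>E {..<r} \<xi> = polydisc r k y"
    using cls(1) unfolding polydisc_def by (intro Set.set_eqI) (simp add: PiE_iff conj_commute Ball_def cong: imp_cong)
  ultimately show ?thesis by (rule that)
qed

text \<open>Modulo \<open>p\<^sup>k\<close> with \<open>k \<ge> j\<close> the congruence \<open>f \<equiv> c (p\<^sup>j)\<close> depends on the residue class only, so the
  solution set is a disjoint union of polydiscs of volume \<open>Q\<^sup>-\<^sup>k\<^sup>r\<close>.\<close>

lemma measure_cong_solutions:
  assumes haar: "is_haar av r \<mu>" and jk: "j \<le> k"
  shows "measure \<mu> (cong_solutions av p r j c) = real (card (residue_solutions av p r k j c)) / real Q ^ (k * r)"
proof -
  let ?T = "cong_solutions av p r j c" and ?S = "residue_solutions av p r k j c"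
  have sub: "?S \<subseteq> {..<r} \<rightarrow>\<^sub>E residue_classes av p k" by (auto simp: residue_solutions_def)
  have fin: "finite ?S"
    by (rule finite_subset[OF sub]) (intro finite_PiE finite_lessThan finite_residue_classes)
  have disc: "\<exists>x. Pi\<^sub>E {..<r} \<xi> = polydisc r k x" if "\<xi> \<in> ?S" for \<xi>
    using residue_solution_polydisc[OF that jk] by metis
  have T: "?T = (\<Union>\<xi>\<in>?S. Pi\<^sub>E {..<r} \<xi>)"
  proof (intro equalityI subsetI)
    fix x assume x: "x \<in> ?T"
    then have xP: "x \<in> {..<r} \<rightarrow>\<^sub>E UNIV" and xi: "\<And>i. i < r \<Longrightarrow> av (x i) \<le> 1"
      and q: "cong_pow av p j (quad r x) c"
      by (simp_all add: cong_solutions_eq integral_polydisc cong_pow_iff)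
    define \<xi> where "\<xi> = (\<lambda>i\<in>{..<r}. {y. av (y - x i) \<le> av p ^ k})"
    have mem: "x i \<in> \<xi> i" if "i < r" for i using that p_pow_pos[of k] by (simp add: \<xi>_def)
    have "\<xi> \<in> {..<r} \<rightarrow>\<^sub>E residue_classes av p k"
      unfolding \<xi>_def restrict_PiE_iff residue_classes_eq using xi by (auto simp: integers_def)
    then have "\<xi> \<in> ?S" using mem q unfolding residue_solutions_def by blast
    moreover have "x \<in> Pi\<^sub>E {..<r} \<xi>" using mem PiE_arb[OF xP] by (intro PiE_I) simp_all
    ultimately show "x \<in> (\<Union>\<xi>\<in>?S. Pi\<^sub>E {..<r} \<xi>)" by blast
  next
    fix x assume "x \<in> (\<Union>\<xi>\<in>?S. Pi\<^sub>E {..<r} \<xi>)"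
    then obtain \<xi> where \<xi>: "\<xi> \<in> ?S" "x \<in> Pi\<^sub>E {..<r} \<xi>" by blast
    obtain y where "y \<in> ?T" "Pi\<^sub>E {..<r} \<xi> = polydisc r k y" by (rule residue_solution_polydisc[OF \<xi>(1) jk])
    then show "x \<in> ?T" using \<xi>(2) polydisc_subset_cong_solutions[of y r j c k] jk by blast
  qed
  have disj: "disjoint_family_on (\<lambda>\<xi>. Pi\<^sub>E {..<r} \<xi>) ?S"
  proof (unfold disjoint_family_on_def, intro ballI impI, rule ccontr)
    fix \<xi> \<eta> assume S: "\<xi> \<in> ?S" "\<eta> \<in> ?S" "\<xi> \<noteq> \<eta>" and "Pi\<^sub>E {..<r} \<xi> \<inter> Pi\<^sub>E {..<r} \<eta> \<noteq> {}"
    then obtain x where x: "x \<in> Pi\<^sub>E {..<r} \<xi>" "x \<in> Pi\<^sub>E {..<r} \<eta>" by blast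
    have P: "\<xi> \<in> {..<r} \<rightarrow>\<^sub>E residue_classes av p k" "\<eta> \<in> {..<r} \<rightarrow>\<^sub>E residue_classes av p k"
      using S sub by blast+
    have "\<xi> i = \<eta> i" if "i \<in> {..<r}" for i
      by (rule trans[OF residue_class_member(1)[OF PiE_mem[OF P(1) that] PiE_mem[OF x(1) that]]
        sym[OF residue_class_member(1)[OF PiE_mem[OF P(2) that] PiE_mem[OF x(2) that]]]])
    then have "\<xi> = \<eta>" by (rule PiE_ext[OF P])
    then show False using S by simp
  qed
  have sets: "(\<lambda>\<xi>. Pi\<^sub>E {..<r} \<xi>) ` ?S \<subseteq> sets \<mu>"
  proof (rule image_subsetI)
    fix \<xi> assume "\<xi> \<in> ?S"
    from disc[OF this] obtain x where "Pi\<^sub>E {..<r} \<xi> = polydisc r k x" ..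
    then show "Pi\<^sub>E {..<r} \<xi> \<in> sets \<mu>" using haar_sets_polydisc[OF haar] by simp
  qed
  have fm: "emeasure \<mu> (Pi\<^sub>E {..<r} \<xi>) \<noteq> \<infinity>" if "\<xi> \<in> ?S" for \<xi>
  proof -
    from disc[OF that] obtain x where "Pi\<^sub>E {..<r} \<xi> = polydisc r k x" ..
    then show ?thesis using haar_finite[OF haar subset_refl, of k x] by simp
  qed
  have "measure \<mu> ?T = (\<Sum>\<xi>\<in>?S. measure \<mu> (Pi\<^sub>E {..<r} \<xi>))"
    unfolding T by (rule measure_finite_Union[OF fin sets disj fm])
  also have "\<dots> = (\<Sum>\<xi>\<in>?S. 1 / real Q ^ (k * r))"
  proof (rule sum.cong[OF refl])
    fix \<xi> assume "\<xi> \<in> ?S"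
    from disc[OF this] obtain x where "Pi\<^sub>E {..<r} \<xi> = polydisc r k x" ..
    then show "measure \<mu> (Pi\<^sub>E {..<r} \<xi>) = 1 / real Q ^ (k * r)" using haar_measure_polydisc[OF haar] by simp
  qed
  finally show ?thesis by simp
qed

subsection \<open>Volume of the solutions near a point of the quadric\<close>

text \<open>At level \<open>K + s\<close> the congruence holds on the whole polydisc, since \<open>f\<close> varies there by at most
  \<open>\<bar>p\<bar>\<^sup>K \<bar>x\<^sub>i\<bar> = \<bar>p\<bar>\<^bsup>K+s\<^esup>\<close>; every further level costs a factor \<open>Q\<close>.\<close>

lemma measure_cong_solutions_polydisc:
  fixes x :: "nat \<Rightarrow> 'f"
  assumes haar: "is_haar av r \<mu>" and x: "x \<in> cong_solutions av p r (K + s) c"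
    and i: "i < r" and xi: "av (x i) = av p ^ s" "s < K" and max: "\<And>l. l < r \<Longrightarrow> av (x l) \<le> av (x i)"
  shows "real Q ^ j * measure \<mu> {y \<in> polydisc r K x. av (quad r y - c) \<le> av p ^ (K + s + j)} = 1 / real Q ^ (K * r)"
proof (induction j)
  case 0
  have "av (quad r y - c) \<le> av p ^ (K + s)" if "y \<in> polydisc r K x" for y
  proof (rule av_diff_trans)
    show "av (quad r y - quad r x) \<le> av p ^ (K + s)"
      unfolding power_add using that max p_pow_mono[of s K] xi p_pow_pos[of K]
      by (intro quad_close) (simp_all add: polydisc_def)
    show "av (quad r x - c) \<le> av p ^ (K + s)" using x by (simp add: cong_solutions_eq)
  qed
  then have "{y \<in> polydisc r K x. av (quad r y - c) \<le> av p ^ (K + s + 0)} = polydisc r K x" by auto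
  then show ?case by (simp add: haar_measure_polydisc[OF haar])
next
  case (Suc j)
  have "\<And>l. l < r \<Longrightarrow> av (x l) \<le> 1" using x by (simp add: cong_solutions_eq integral_polydisc)
  then have "measure \<mu> {y \<in> polydisc r K x. av (quad r y - c) \<le> av p ^ (K + s + j)}
     = real Q * measure \<mu> {y \<in> polydisc r K x. av (quad r y - c) \<le> av p ^ Suc (K + s + j)}"
    by (intro measure_congruence_step[where x = x and i = i and s = s, OF haar _ i xi]) simp_all
  then show ?case using Suc by (simp add: mult_ac)
qed

text \<open>An approximate solution is corrected in one coordinate only.\<close>

lemma hensel_quad:
  assumes "i < r" "av p ^ k < av (x i)" "av (quad r x - c) \<le> av p ^ k * av (x i)"
  obtains u where "quad r (x(i := u)) = c" "av (u - x i) \<le> av p ^ k"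
proof -
  obtain u where u: "u\<^sup>2 = (x i)\<^sup>2 + (c - quad r x)" "av (u - x i) \<le> av p ^ k"
    using hensel_sqrt[OF complete av_2, of "av p ^ k" "x i" "(x i)\<^sup>2 + (c - quad r x)"] assms p_pow_pos[of k]
    by (auto simp: av_commute[of c])
  have "quad r (x(i := x i + (u - x i))) = quad r x + 2 * x i * (u - x i) + (u - x i)\<^sup>2"
    by (rule quad_shift[OF assms(1)])
  also have "\<dots> = quad r x + (u\<^sup>2 - (x i)\<^sup>2)" by (simp add: power2_eq_square algebra_simps)
  finally show ?thesis using that[of u] u by simp
qed

lemma max_coordinate:
  assumes "0 < r" "quad r x \<noteq> 0"
  obtains i where "i < r" "\<And>l. l < r \<Longrightarrow> av (x l) \<le> av (x i)" "av (quad r x) \<le> av (x i) * av (x i)" "x i \<noteq> 0"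
proof -
  obtain i where i: "i < r" "sup_abs av r x = av (x i)" using assms(1) by (rule sup_abs_attained)
  have le: "av (x l) \<le> av (x i)" if "l < r" for l using av_le_sup_abs[OF that, of x] i by simp
  have "av (quad r x) \<le> av (x i) * av (x i)"
    unfolding quad_def power2_eq_square
    by (rule av_sum_le) (use le in \<open>auto simp: av_mult intro!: mult_mono\<close>)
  moreover have "x i \<noteq> 0"
  proof
    assume "x i = 0"
    then have "av (quad r x) = 0" using calculation by (intro antisym) simp_all
    then show False using assms(2) by simp
  qed
  ultimately show ?thesis using that i le by blast
qed

text \<open>A lower bound for \<open>\<bar>f(x)\<bar>\<close> bounds the largest coordinate from below, because \<open>\<bar>f(x)\<bar> \<le> \<bar>x\<^sub>i\<bar>\<^sup>2\<close>.  This is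
  how one radius serves all points of the quadric.\<close>

lemma integral_max_coordinate:
  assumes "0 < r" "x \<in> polydisc r 0 (\<lambda>_. 0)" "av p ^ K < av (quad r x)"
  obtains i s where "i < r" "\<And>l. l < r \<Longrightarrow> av (x l) \<le> av (x i)" "av (x i) = av p ^ s" "s < K"
proof -
  have "quad r x \<noteq> 0" using order.strict_trans[OF p_pow_pos assms(3)] by simp
  then obtain i where i: "i < r" "\<And>l. l < r \<Longrightarrow> av (x l) \<le> av (x i)"
    and q: "av (quad r x) \<le> av (x i) * av (x i)" and ne: "x i \<noteq> 0"
    using max_coordinate[OF assms(1)] by metis
  obtain e :: int where e: "av (x i) = av p powi e" using av_discrete[OF ne] by blast
  have le1: "av (x i) \<le> 1" using assms(2) i(1) by (simp add: integral_polydisc)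
  have "e \<ge> 0"
  proof (rule ccontr)
    assume "\<not> e \<ge> 0"
    then have "av (x i) = inverse (av p) ^ nat (- e)" using e by (simp add: power_int_def)
    moreover have "1 < inverse (av p) ^ nat (- e)"
      using \<open>\<not> e \<ge> 0\<close> p_pos p_less_1 by (intro one_less_power) (auto simp: one_less_inverse)
    ultimately show False using le1 by simp
  qed
  then have s: "av (x i) = av p ^ nat e" using e by (simp add: power_int_def)
  have "av p ^ K < av p ^ (nat e + nat e)" using q assms(3) s by (simp add: power_add)
  then have "nat e < K" unfolding p_pow_less_iff by linarith
  then show ?thesis using that i s by blast
qed

end

section \<open>The gauge form at a point\<close>

context
  fixes emb :: "'a :: comm_ring_1 \<Rightarrow> 'b :: comm_ring_1"
  assumes hom: "\<And>c d. emb (c + d) = emb c + emb d" "\<And>c d. emb (c * d) = emb c * emb d"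
    "emb 0 = 0" "emb 1 = 1"
begin

lemma meval_superset:
  assumes "finite A" "Poly_Mapping.keys P \<subseteq> A"
  shows "meval emb P x = (\<Sum>m \<in> A. emb (Poly_Mapping.lookup P m) *
     (\<Prod>i \<in> Poly_Mapping.keys m. x i ^ Poly_Mapping.lookup m i))"
  unfolding meval_def
  by (rule sum.mono_neutral_left) (use assms hom in \<open>auto simp: in_keys_iff\<close>)

lemma meval_single:
  "meval emb (Poly_Mapping.single m c) x = emb c * (\<Prod>i \<in> Poly_Mapping.keys m. x i ^ Poly_Mapping.lookup m i)"
  by (subst meval_superset[of "{m}"]) (auto simp: hom)

lemma meval_add: "meval emb (P + Q) x = meval emb P x + meval emb Q x"
proof -
  let ?A = "Poly_Mapping.keys P \<union> Poly_Mapping.keys Q"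
  have "Poly_Mapping.keys (P + Q) \<subseteq> ?A" by (rule Poly_Mapping.keys_add)
  then show ?thesis
    by (simp add: meval_superset[of ?A] lookup_add distrib_right sum.distrib hom)
qed

lemma meval_0: "meval emb 0 x = 0"
  by (simp add: meval_def)

lemma meval_sum: "meval emb (\<Sum>i\<in>A. P i) x = (\<Sum>i\<in>A. meval emb (P i) x)"
  by (induction A rule: infinite_finite_induct) (simp_all add: meval_0 meval_add)

lemma meval_minus: "meval emb (- P) x = - meval emb P x"
  using meval_add[of P "- P" x] by (simp add: meval_0 eq_neg_iff_add_eq_0 add.commute)

lemma meval_diff: "meval emb (P - Q) x = meval emb P x - meval emb Q x"
  using meval_add[of P "- Q" x] by (simp add: meval_minus)

lemma monomial_value_superset:
  fixes x :: "nat \<Rightarrow> 'b"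
  assumes "finite A" "Poly_Mapping.keys m \<subseteq> A"
  shows "(\<Prod>i \<in> Poly_Mapping.keys m. x i ^ Poly_Mapping.lookup m i) = (\<Prod>i \<in> A. x i ^ Poly_Mapping.lookup m i)"
  by (rule prod.mono_neutral_left) (use assms in \<open>auto simp: in_keys_iff\<close>)

lemma monomial_value_add:
  fixes x :: "nat \<Rightarrow> 'b" and m m' :: "nat \<Rightarrow>\<^sub>0 nat"
  shows "(\<Prod>i \<in> Poly_Mapping.keys (m + m'). x i ^ Poly_Mapping.lookup (m + m') i)
    = (\<Prod>i \<in> Poly_Mapping.keys m. x i ^ Poly_Mapping.lookup m i)
      * (\<Prod>i \<in> Poly_Mapping.keys m'. x i ^ Poly_Mapping.lookup m' i)"
proof -
  let ?A = "Poly_Mapping.keys m \<union> Poly_Mapping.keys m'"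
  have "Poly_Mapping.keys (m + m') \<subseteq> ?A" by (rule Poly_Mapping.keys_add)
  then have "(\<Prod>i \<in> Poly_Mapping.keys (m + m'). x i ^ Poly_Mapping.lookup (m + m') i)
    = (\<Prod>i \<in> ?A. x i ^ Poly_Mapping.lookup (m + m') i)"
    by (intro monomial_value_superset) simp_all
  also have "\<dots> = (\<Prod>i \<in> ?A. x i ^ Poly_Mapping.lookup m i) * (\<Prod>i \<in> ?A. x i ^ Poly_Mapping.lookup m' i)"
    by (simp add: lookup_add power_add prod.distrib)
  finally show ?thesis
    by (simp add: monomial_value_superset[of ?A m] monomial_value_superset[of ?A m'])
qed

lemma sum_monomials: "P = (\<Sum>m \<in> Poly_Mapping.keys P. Poly_Mapping.single m (Poly_Mapping.lookup P m))"
  for P :: "'a mpol"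
  by (rule poly_mapping_eqI) (simp add: lookup_sum lookup_single when_def in_keys_iff)

lemma meval_mult: "meval emb (P * Q) x = meval emb P x * meval emb Q x"
proof -
  have "meval emb (P * Q) x = meval emb ((\<Sum>m \<in> Poly_Mapping.keys P. Poly_Mapping.single m (Poly_Mapping.lookup P m)) *
     (\<Sum>m \<in> Poly_Mapping.keys Q. Poly_Mapping.single m (Poly_Mapping.lookup Q m))) x"
    by (simp flip: sum_monomials)
  also have "\<dots> = (\<Sum>m \<in> Poly_Mapping.keys P. meval emb (Poly_Mapping.single m (Poly_Mapping.lookup P m)) x) *
     (\<Sum>m \<in> Poly_Mapping.keys Q. meval emb (Poly_Mapping.single m (Poly_Mapping.lookup Q m)) x)"
    by (simp add: sum_product meval_sum mult_single meval_single monomial_value_add hom mult_ac)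
  also have "\<dots> = meval emb P x * meval emb Q x"
    by (simp only: meval_sum[symmetric] sum_monomials[symmetric])
  finally show ?thesis .
qed

lemma meval_const: "meval emb (mconst c) x = emb c"
  by (simp add: mconst_def meval_single)

lemma meval_var: "meval emb (mvar i) x = x i"
  by (simp add: mvar_def meval_single hom)

lemma meval_1: "meval emb 1 x = 1"
  using meval_const[of 1 x] by (simp add: mconst_def hom)

lemma meval_sign: "meval emb ((- 1) ^ k) x = (- 1) ^ k"
  by (induction k) (simp_all add: meval_1 meval_mult meval_minus)

end

text \<open>Evaluation at a point of the quadric kills the multiple of \<open>f - a\<close> in the identity that defines a
  gauge form.  What remains says that the signed coefficients of \<open>\<omega>\<close> pair with the gradient \<open>2 x\<close> to
  \<open>\<plusminus>1\<close>.\<close>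

lemma gauge_form_at_point:
  fixes emb :: "'a :: field \<Rightarrow> 'b :: field"
  assumes hom: "\<And>c d. emb (c + d) = emb c + emb d" "\<And>c d. emb (c * d) = emb c * emb d"
      "emb 0 = 0" "emb 1 = 1"
    and g: "gauge_form r b g" and x: "quad r x = emb b"
  obtains \<epsilon> where "\<epsilon> = 1 \<or> \<epsilon> = - 1"
    "(\<Sum>i<r. (- 1) ^ (r - 1 - i) * meval emb (g i) x * (2 * x i)) = \<epsilon>"
proof -
  note ev = meval_diff[OF hom] meval_sum[OF hom] meval_mult[OF hom] meval_sign[OF hom]
    meval_const[OF hom] meval_var[OF hom] meval_1[OF hom] meval_minus[OF hom]
  have emb2: "emb 2 = 2" using hom(1)[of 1 1] hom(4) by simp
  obtain \<epsilon> :: "'a mpol" and h where \<epsilon>: "\<epsilon> \<in> {1, -1}" and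
    eq: "(\<Sum>i<r. (-1) ^ (r - 1 - i) * g i * mpderiv i (quad_poly r)) - \<epsilon> = h * (quad_poly r - mconst b)"
    using g unfolding gauge_form_def by blast
  have f: "meval emb (quad_poly r) x = quad r x" by (rule meval_quad_poly[OF hom(1,3,4)])
  have "(\<Sum>i<r. (- 1) ^ (r - 1 - i) * meval emb (g i) x * meval emb (mpderiv i (quad_poly r)) x) - meval emb \<epsilon> x
    = meval emb h x * (quad r x - emb b)"
    using arg_cong[OF eq, of "\<lambda>P. meval emb P x"] by (simp add: ev f)
  moreover have "meval emb (mpderiv i (quad_poly r)) x = 2 * x i" if "i < r" for i
    using that by (simp add: mpderiv_quad_poly ev emb2)
  ultimately have "(\<Sum>i<r. (- 1) ^ (r - 1 - i) * meval emb (g i) x * (2 * x i)) = meval emb \<epsilon> x"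
    using x by simp
  moreover have "meval emb \<epsilon> x = 1 \<or> meval emb \<epsilon> x = - 1" using \<epsilon> by (auto simp: ev)
  ultimately show ?thesis using that by blast
qed

text \<open>Cramer's rule for the square matrix whose rows are the tangent vectors \<open>\<partial>\<phi>/\<partial>y\<^sub>j\<close> and the signed
  coefficients of \<open>\<omega>\<close>: its determinant is the pullback of \<open>\<omega>\<close>, by expansion along the last row, and it
  sends the normal vector \<open>\<nu>\<close> to \<open>(0, \<dots>, 0, \<epsilon>)\<close>.  For a graph over all coordinates but the \<open>i\<close>-th, deleting
  column \<open>i\<close> and the last row leaves the identity matrix.\<close>

lemma pullback_normal:
  fixes D :: "nat \<Rightarrow> nat \<Rightarrow> 'b :: field"
  assumes i: "i < r"
    and graph: "\<And>k j. k < r - 1 \<Longrightarrow> j < r - 1 \<Longrightarrow> D (insert_index i k) j = (if k = j then 1 else 0)"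
    and tangent: "\<And>j. j < r - 1 \<Longrightarrow> (\<Sum>l<r. \<nu> l * D l j) = 0"
    and gauge: "(\<Sum>l<r. (- 1) ^ (r - 1 - l) * G l * \<nu> l) = \<epsilon>"
  shows "\<nu> i * (\<Sum>l<r. G l * minor r D l) = (- 1) ^ (r - 1 + i) * \<epsilon>"
proof -
  define A where "A = Matrix.mat r r (\<lambda>(a, l). if a < r - 1 then D l a else (- 1) ^ (r - 1 - l) * G l)"
  define n where "n = Matrix.vec r \<nu>"
  have A: "A \<in> carrier_mat r r" and n: "n \<in> carrier_vec r" by (simp_all add: A_def n_def)
  have del: "mat_delete A (r - 1) l = transpose_mat (Matrix.mat (r - 1) (r - 1) (\<lambda>(k, j). D (insert_index l k) j))"
    if "l < r" for l
    by (rule eq_matI) (use that in \<open>auto simp: mat_delete_def A_def insert_index_def transpose_mat_def\<close>)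
  have "Determinant.det A = (\<Sum>l<r. A $$ (r - 1, l) * cofactor A (r - 1) l)"
    by (rule laplace_expansion_row[OF A]) (use i in simp)
  also have "\<dots> = (\<Sum>l<r. G l * minor r D l)"
  proof (rule sum.cong[OF refl])
    fix l assume "l \<in> {..<r}"
    then have l: "l < r" by simp
    have "Determinant.det (mat_delete A (r - 1) l) = minor r D l"
      unfolding del[OF l] minor_def by (rule det_transpose[where n = "r - 1"]) simp
    moreover have "(- 1) ^ (r - 1 - l) * (- 1) ^ (r - 1 + l) = (1 :: 'b)"
      using l by (simp flip: power_add)
    ultimately show "A $$ (r - 1, l) * cofactor A (r - 1) l = G l * minor r D l"
      using l i by (simp add: A_def cofactor_def mult_ac)
  qed
  finally have detA: "Determinant.det A = (\<Sum>l<r. G l * minor r D l)" .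
  have An: "(A *\<^sub>v n) $ a = (if a = r - 1 then \<epsilon> else 0)" if "a < r" for a
  proof (cases "a = r - 1")
    case True
    then show ?thesis using that gauge
      by (simp add: A_def n_def mult_mat_vec_def scalar_prod_def atLeast0LessThan)
  next
    case False
    then have "a < r - 1" using that by linarith
    then show ?thesis using that tangent[of a]
      by (simp add: A_def n_def mult_mat_vec_def scalar_prod_def atLeast0LessThan mult.commute)
  qed
  \<comment> \<open>The determinant in the numerator of Cramer's rule has one nonzero entry in column \<open>i\<close>.\<close>
  let ?B = "replace_col A (A *\<^sub>v n) i"
  have B: "?B \<in> carrier_mat r r" using A by (simp add: replace_col_def)
  have Bi: "?B $$ (a, i) = (if a = r - 1 then \<epsilon> else 0)" if "a < r" for a
    using An[OF that] that A i by (simp add: replace_col_def)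
  have "mat_delete ?B (r - 1) i = 1\<^sub>m (r - 1)"
  proof (rule eq_matI)
    fix a k assume "a < dim_row (1\<^sub>m (r - 1) :: 'b mat)" "k < dim_col (1\<^sub>m (r - 1) :: 'b mat)"
    then have ak: "a < r - 1" "k < r - 1" by simp_all
    have "mat_delete ?B (r - 1) i $$ (a, k) = D (insert_index i k) a"
      using ak i by (auto simp: mat_delete_def replace_col_def A_def insert_index_def)
    then show "mat_delete ?B (r - 1) i $$ (a, k) = 1\<^sub>m (r - 1) $$ (a, k)"
      using ak graph[of k a] by auto
  qed (use A in \<open>simp_all add: mat_delete_def replace_col_def\<close>)
  then have cof: "cofactor ?B (r - 1) i = (- 1) ^ (r - 1 + i)" by (simp add: cofactor_def)
  have "Determinant.det ?B = (\<Sum>a<r. ?B $$ (a, i) * cofactor ?B a i)"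
    by (rule laplace_expansion_column[OF B i])
  also have "\<dots> = (\<Sum>a<r. if a = r - 1 then \<epsilon> * cofactor ?B (r - 1) i else 0)"
    by (rule sum.cong[OF refl]) (simp add: Bi)
  also have "\<dots> = \<epsilon> * cofactor ?B (r - 1) i" using i by simp
  also have "\<dots> = \<epsilon> * (- 1) ^ (r - 1 + i)" by (simp only: cof)
  finally have "Determinant.det ?B = \<epsilon> * (- 1) ^ (r - 1 + i)" .
  then show ?thesis
    using cramer_lemma_mat[OF A n i] i by (simp add: detA n_def mult.commute)
qed

section \<open>Charts of the quadric\<close>

lemma sum_insert_index:
  fixes F :: "nat \<Rightarrow> 'c :: comm_monoid_add"
  assumes "i < r"
  shows "(\<Sum>l<r. F l) = F i + (\<Sum>j<r - 1. F (insert_index i j))"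
proof -
  have "insert_index i ` {..<r - 1} = {..<r} - {i}"
    using insert_index_image[of i "r - 1"] assms by (simp add: atLeast0LessThan)
  then have "(\<Sum>j<r - 1. F (insert_index i j)) = (\<Sum>l\<in>{..<r} - {i}. F l)"
    using sum.reindex[OF insert_index_inj_on, of F i "{..<r - 1}"] by (simp add: o_def)
  then show ?thesis using assms by (simp add: sum.remove[of "{..<r}" i])
qed

lemma insert_index_less: "i < r \<Longrightarrow> j < r - 1 \<Longrightarrow> insert_index i j < r"
  by (auto simp: insert_index_def)

lemma delete_index_less: "i < r \<Longrightarrow> l < r \<Longrightarrow> l \<noteq> i \<Longrightarrow> delete_index i l < r - 1"
  by (auto simp: delete_index_def)

lemma insert_delete_index_neq: "l \<noteq> i \<Longrightarrow> insert_index i (delete_index i l) = l"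
  by (auto simp: insert_index_def delete_index_def)

lemma insert_index_eq_iff: "insert_index i j = insert_index i j' \<longleftrightarrow> j = j'"
  by (metis delete_insert_index)

lemma quad_insert_index: "i < r \<Longrightarrow> quad r x = (x i)\<^sup>2 + quad (r - 1) (\<lambda>j. x (insert_index i j))"
  unfolding quad_def by (rule sum_insert_index)

text \<open>Around a point \<open>x0\<close> of the quadric whose \<open>i\<close>-th coordinate has maximal absolute value, the other
  coordinates \<open>y\<close> are a chart, with \<open>x\<^sub>i = h y\<close> a square root of \<open>b - \<Sum> y\<^sub>j\<^sup>2\<close>.  Maximality makes
  \<open>\<bar>b - \<Sum> y\<^sub>j\<^sup>2 - x0\<^sub>i\<^sup>2\<bar>\<close> so small that the root exists for every \<open>y\<close> in the polydisc, not only near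
  its centre.\<close>

locale quadric_chart = odd_local_field av p Q R
  for av :: "'f :: field \<Rightarrow> real" and p Q R +
  fixes r i k :: nat and x0 :: "nat \<Rightarrow> 'f" and b :: 'f
  assumes r_ge_2: "2 \<le> r" and i_less: "i < r"
    and x0_point: "x0 \<in> X_points r b"
    and x0_max: "\<And>l. l < r \<Longrightarrow> av (x0 l) \<le> av (x0 i)"
    and radius: "av p ^ k < av (x0 i)"
begin

definition proj :: "(nat \<Rightarrow> 'f) \<Rightarrow> nat \<Rightarrow> 'f" where
  "proj x = (\<lambda>j\<in>{..<r - 1}. x (insert_index i j))"

definition V :: "(nat \<Rightarrow> 'f) set" where
  "V = polydisc (r - 1) k (proj x0)"

definition h :: "(nat \<Rightarrow> 'f) \<Rightarrow> 'f" where
  "h y = (SOME u. u\<^sup>2 = b - quad (r - 1) y \<and> av (u - x0 i) \<le> av p ^ k)"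

definition param :: "(nat \<Rightarrow> 'f) \<Rightarrow> nat \<Rightarrow> 'f" where
  "param y = (\<lambda>l\<in>{..<r}. if l = i then h y else y (delete_index i l))"

text \<open>Implicit differentiation of \<open>h\<^sup>2 = b - \<Sum> y\<^sub>j\<^sup>2\<close> gives \<open>\<partial>h/\<partial>y\<^sub>j = - y\<^sub>j / h\<close>.\<close>

definition jac :: "(nat \<Rightarrow> 'f) \<Rightarrow> nat \<Rightarrow> nat \<Rightarrow> 'f" where
  "jac y l j = (if l = i then - (y j / h y) else if l = insert_index i j then 1 else 0)"

lemma delta_pos: "0 < av (x0 i)"
  using radius p_pow_pos[of k] by linarith

lemma quad_x0: "quad r x0 = b" and x0_PiE: "x0 \<in> {..<r} \<rightarrow>\<^sub>E UNIV"
  using x0_point by (simp_all add: X_points_def)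

lemma V_subset: "V \<subseteq> {..<r - 1} \<rightarrow>\<^sub>E UNIV"
  unfolding V_def by (rule polydisc_subset)

lemma proj_x0_le: "j < r - 1 \<Longrightarrow> av (proj x0 j) \<le> av (x0 i)"
  using i_less by (simp add: proj_def x0_max insert_index_less)

lemma V_coord:
  assumes "y \<in> V" "j < r - 1"
  shows "av (y j - proj x0 j) \<le> av p ^ k" "av (y j) \<le> av (x0 i)"
proof -
  show 1: "av (y j - proj x0 j) \<le> av p ^ k" using assms by (simp add: V_def polydisc_def)
  have "av ((y j - proj x0 j) + proj x0 j) \<le> av (x0 i)"
    using 1 radius proj_x0_le[OF assms(2)] by (intro av_add_le) simp_all
  then show "av (y j) \<le> av (x0 i)" by simp
qed

lemma quad_proj: "quad r x = (x i)\<^sup>2 + quad (r - 1) (proj x)" for x :: "nat \<Rightarrow> 'f"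
  unfolding quad_insert_index[OF i_less, of x] by (simp add: quad_def proj_def)

lemma h_root:
  assumes "y \<in> V"
  shows "(h y)\<^sup>2 = b - quad (r - 1) y" "av (h y - x0 i) \<le> av p ^ k"
proof -
  have "av (quad (r - 1) y - quad (r - 1) (proj x0)) \<le> av p ^ k * av (x0 i)"
    using V_coord(1)[OF assms] proj_x0_le p_pow_pos[of k] radius by (intro quad_close) simp_all
  moreover have "(b - quad (r - 1) y) - (x0 i)\<^sup>2 = quad (r - 1) (proj x0) - quad (r - 1) y"
    using quad_proj[of x0] quad_x0 by (simp add: algebra_simps)
  ultimately have "av ((b - quad (r - 1) y) - (x0 i)\<^sup>2) \<le> av p ^ k * av (x0 i)"
    using av_commute by metis
  then obtain u where "u\<^sup>2 = b - quad (r - 1) y \<and> av (u - x0 i) \<le> av p ^ k"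
    using hensel_sqrt[OF complete av_2 less_imp_le[OF p_pow_pos] radius] by metis
  then have "(h y)\<^sup>2 = b - quad (r - 1) y \<and> av (h y - x0 i) \<le> av p ^ k"
    unfolding h_def by (rule someI)
  then show "(h y)\<^sup>2 = b - quad (r - 1) y" "av (h y - x0 i) \<le> av p ^ k" by simp_all
qed

text \<open>Near \<open>x0\<^sub>i\<close> a sum of two elements is close to \<open>2 x0\<^sub>i\<close>.  So the root near \<open>x0\<^sub>i\<close> is unique, and
  differences of roots can be read off from differences of squares.\<close>

lemma near_sum:
  assumes "av (u - x0 i) \<le> av p ^ k" "av (u' - x0 i) \<le> av p ^ k"
  shows "av (u + u') = av (x0 i)"
proof -
  have "av ((u - x0 i) + (u' - x0 i)) \<le> av p ^ k" by (rule av_add_le[OF assms])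
  then have "av ((u + u') - 2 * x0 i) < av (2 * x0 i)"
    using radius by (simp add: av_mult av_2 algebra_simps)
  then show ?thesis using av_dominant[of "u + u'" "2 * x0 i"] by (simp add: av_mult av_2)
qed

lemma av_h: "y \<in> V \<Longrightarrow> av (h y) = av (x0 i)"
  using av_dominant[of "h y" "x0 i"] h_root(2)[of y] radius by simp

lemma h_nonzero: "y \<in> V \<Longrightarrow> h y \<noteq> 0"
  using av_h[of y] delta_pos by auto

lemma h_unique:
  assumes "y \<in> V" "u\<^sup>2 = b - quad (r - 1) y" "av (u - x0 i) \<le> av p ^ k"
  shows "h y = u"
proof -
  have "(h y)\<^sup>2 = u\<^sup>2" using h_root(1)[OF assms(1)] assms(2) by simp
  then have "(h y - u) * (h y + u) = 0" by (simp add: power2_eq_square algebra_simps)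
  moreover have "h y + u \<noteq> 0" using near_sum[OF h_root(2)[OF assms(1)] assms(3)] delta_pos by auto
  ultimately show ?thesis by simp
qed

lemma h_diff:
  assumes "y \<in> V" "z \<in> V"
  shows "(h y - h z) * (h y + h z) = - (\<Sum>j<r - 1. (y j - z j) * (y j + z j))"
proof -
  have "(h y - h z) * (h y + h z) = (h y)\<^sup>2 - (h z)\<^sup>2" by (simp add: power2_eq_square algebra_simps)
  also have "\<dots> = - (quad (r - 1) y - quad (r - 1) z)" by (simp add: h_root(1)[OF assms(1)] h_root(1)[OF assms(2)])
  finally show ?thesis unfolding quad_diff .
qed

lemma h_lipschitz:
  assumes "y \<in> V" "z \<in> V" "0 \<le> C" "\<And>j. j < r - 1 \<Longrightarrow> av (y j - z j) \<le> C"
  shows "av (h y - h z) \<le> C"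
proof -
  have "av (\<Sum>j<r - 1. (y j - z j) * (y j + z j)) \<le> C * av (x0 i)"
  proof (rule av_sum_le)
    fix j assume "j \<in> {..<r - 1}"
    then have j: "j < r - 1" by simp
    have "av (y j + z j) \<le> av (x0 i)" using V_coord(2)[OF assms(1) j] V_coord(2)[OF assms(2) j] by (rule av_add_le)
    then show "av ((y j - z j) * (y j + z j)) \<le> C * av (x0 i)"
      unfolding av_mult using assms(3) assms(4)[OF j] by (intro mult_mono) simp_all
  qed (use assms(3) in simp)
  then have "av ((h y - h z) * (h y + h z)) \<le> C * av (x0 i)"
    unfolding h_diff[OF assms(1,2)] by simp
  then show ?thesis
    unfolding av_mult near_sum[OF h_root(2)[OF assms(1)] h_root(2)[OF assms(2)]] using delta_pos by simp
qed

lemma param_simps: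
  "param y i = h y" "j < r - 1 \<Longrightarrow> param y (insert_index i j) = y j"
  using i_less insert_index_less[OF i_less, of j]
  by (simp_all add: param_def insert_index_exclude delete_insert_index)

lemma proj_param: "y \<in> V \<Longrightarrow> proj (param y) = y"
  by (rule PiE_ext[of _ "{..<r - 1}" "\<lambda>_. UNIV"]) (use V_subset in \<open>auto simp: proj_def param_simps\<close>)

lemma image_param: "param ` V = X_points r b \<inter> polydisc r k x0"
proof (intro equalityI subsetI)
  fix x assume "x \<in> param ` V"
  then obtain y where y: "y \<in> V" "x = param y" by blast
  have x: "x \<in> {..<r} \<rightarrow>\<^sub>E UNIV" unfolding y(2) param_def by simp
  have "quad r x = (h y)\<^sup>2 + quad (r - 1) y"
    unfolding quad_proj y(2) proj_param[OF y(1)] param_simps by simp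
  then have "quad r x = b" by (simp add: h_root(1)[OF y(1)])
  moreover have "av (x l - x0 l) \<le> av p ^ k" if "l < r" for l
  proof (cases "l = i")
    case True
    then show ?thesis using h_root(2)[OF y(1)] by (simp add: y(2) param_simps)
  next
    case False
    have del: "delete_index i l < r - 1" by (rule delete_index_less[OF i_less that False])
    then show ?thesis
      using V_coord(1)[OF y(1) del] that False del unfolding y(2) param_def proj_def
      by (simp add: insert_delete_index_neq)
  qed
  ultimately show "x \<in> X_points r b \<inter> polydisc r k x0"
    using x by (simp add: X_points_def polydisc_def)
next
  fix x assume "x \<in> X_points r b \<inter> polydisc r k x0"
  then have xP: "x \<in> {..<r} \<rightarrow>\<^sub>E UNIV" and q: "quad r x = b"
    and near: "\<And>l. l < r \<Longrightarrow> av (x l - x0 l) \<le> av p ^ k"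
    by (simp_all add: X_points_def polydisc_def)
  have V: "proj x \<in> V" using near insert_index_less[OF i_less] by (simp add: V_def polydisc_def proj_def)
  have "h (proj x) = x i"
    by (rule h_unique[OF V]) (use q quad_proj[of x] near[OF i_less] in \<open>simp_all add: algebra_simps\<close>)
  then have "x l = param (proj x) l" if "l < r" for l
    using that delete_index_less[OF i_less that]
    by (simp add: param_def proj_def insert_delete_index_neq)
  then have "x = param (proj x)"
    by (intro PiE_ext[OF xP, of "param (proj x)"]) (simp_all add: param_def)
  then show "x \<in> param ` V" using V by blast
qed

lemma homeomorphic_param:
  "homeomorphic_map (subtopology (affine_topology av (r - 1)) V)
     (subtopology (affine_topology av r) (param ` V)) param"
proof -
  have "continuous_map (subtopology (affine_topology av (r - 1)) V) (affine_topology av r) param"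
  proof (rule continuous_map_affineI[OF V_subset])
    fix x y C l assume xy: "x \<in> V" "y \<in> V" and C: "0 \<le> C" "\<And>j. j < r - 1 \<Longrightarrow> av (x j - y j) \<le> C" and l: "l < r"
    show "av (param x l - param y l) \<le> C"
    proof (cases "l = i")
      case True
      then show ?thesis using h_lipschitz[OF xy C] by (simp add: param_simps)
    next
      case False
      then show ?thesis using C(2)[OF delete_index_less[OF i_less l False]] l by (simp add: param_def)
    qed
  qed (simp add: param_def)
  moreover have "continuous_map (subtopology (affine_topology av r) (param ` V)) (affine_topology av (r - 1)) proj"
  proof (rule continuous_map_affineI)
    show "param ` V \<subseteq> {..<r} \<rightarrow>\<^sub>E UNIV" by (rule image_subsetI) (simp add: param_def)
    fix x y C j assume "\<And>j. j < r \<Longrightarrow> av (x j - y j) \<le> C" and j: "j < r - 1"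
    then show "av (proj x j - proj y j) \<le> C"
      using insert_index_less[OF i_less j] by (simp add: proj_def)
  qed (simp add: proj_def)
  moreover have inv: "proj x \<in> V \<and> param (proj x) = x" if x: "x \<in> param ` V" for x
  proof -
    obtain y where "y \<in> V" "x = param y" using x by (rule imageE)
    then show ?thesis by (simp add: proj_param)
  qed
  ultimately have "homeomorphic_maps (subtopology (affine_topology av (r - 1)) V)
     (subtopology (affine_topology av r) (param ` V)) param proj"
    unfolding homeomorphic_maps_def continuous_map_in_subtopology
    by (simp add: proj_param image_subset_iff Pi_iff)
  then show ?thesis unfolding homeomorphic_map_maps by blast
qed

text \<open>Only the coordinate \<open>h\<close> is not linear.  After multiplication by \<open>(h z + h w) h y\<close> the error of its linear
  approximation becomes \<open>\<Sum> (z\<^sub>j - w\<^sub>j) (y\<^sub>j ((h z - h y) + (h w - h y)) - h y ((z\<^sub>j - y\<^sub>j) + (w\<^sub>j - y\<^sub>j)))\<close>, and the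
  second factor is small since \<open>h\<close> is Lipschitz.\<close>

lemma strict_deriv_param:
  assumes y: "y \<in> V"
  shows "strict_deriv av (r - 1) r V param y (jac y)"
  unfolding strict_deriv_def
proof (intro allI impI)
  fix e :: real assume e: "0 < e"
  \<comment> \<open>\<open>(h z + h w) h y\<close> has absolute value \<open>\<bar>x0\<^sub>i\<bar>\<^sup>2\<close>, of which the coefficients \<open>y\<^sub>j\<close> and \<open>h y\<close> cancel one factor.\<close>
  let ?d = "e * av (x0 i)"
  have r1: "0 < r - 1" "0 < r" using r_ge_2 by simp_all
  show "\<exists>\<delta>>0. \<forall>z\<in>V. \<forall>w\<in>V. sup_abs av (r - 1) (\<lambda>j. z j - y j) < \<delta> \<longrightarrow>
     sup_abs av (r - 1) (\<lambda>j. w j - y j) < \<delta> \<longrightarrow>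
     sup_abs av r (\<lambda>l. param z l - param w l - (\<Sum>j<r - 1. jac y l j * (z j - w j)))
       \<le> e * sup_abs av (r - 1) (\<lambda>j. z j - w j)"
  proof (intro exI[of _ ?d] conjI ballI impI)
    show "0 < ?d" using e delta_pos by simp
    fix z w assume z: "z \<in> V" and w: "w \<in> V"
      and zd: "sup_abs av (r - 1) (\<lambda>j. z j - y j) < ?d" and wd: "sup_abs av (r - 1) (\<lambda>j. w j - y j) < ?d"
    let ?S = "sup_abs av (r - 1) (\<lambda>j. z j - w j)"
    have S: "0 \<le> ?S" by (rule sup_abs_nonneg[OF r1(1)])
    have zy: "av (z j - y j) \<le> ?d" and wy: "av (w j - y j) \<le> ?d" if "j < r - 1" for j
      using av_le_sup_abs[OF that, of "\<lambda>j. z j - y j"] av_le_sup_abs[OF that, of "\<lambda>j. w j - y j"] zd wd by simp_all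
    have hz: "av (h z - h y) \<le> ?d" and hw: "av (h w - h y) \<le> ?d"
      using h_lipschitz[OF z y _ zy] h_lipschitz[OF w y _ wy] e delta_pos by simp_all
    let ?E = "h z - h w + (\<Sum>j<r - 1. y j / h y * (z j - w j))"
    have "?E * (h z + h w) * h y = (h z - h w) * (h z + h w) * h y + (\<Sum>j<r - 1. y j / h y * (z j - w j)) * (h z + h w) * h y"
      by (simp add: algebra_simps)
    also have "\<dots> = (\<Sum>j<r - 1. y j / h y * (z j - w j) * (h z + h w) * h y - (z j - w j) * (z j + w j) * h y)"
      unfolding h_diff[OF z w] by (simp add: sum_distrib_right sum_subtractf sum_negf)
    also have "\<dots> = (\<Sum>j<r - 1. (z j - w j) * (y j * ((h z - h y) + (h w - h y)) - h y * ((z j - y j) + (w j - y j))))"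
      using h_nonzero[OF y] by (intro sum.cong refl) (simp add: field_simps)
    finally have E: "?E * (h z + h w) * h y = \<dots>" .
    have "av (?E * (h z + h w) * h y) \<le> ?S * (av (x0 i) * ?d)"
      unfolding E
    proof (rule av_sum_le)
      fix j assume "j \<in> {..<r - 1}"
      then have j: "j < r - 1" by simp
      have "av (y j * ((h z - h y) + (h w - h y))) \<le> av (x0 i) * ?d"
        unfolding av_mult using V_coord(2)[OF y j] av_add_le[OF hz hw] delta_pos by (intro mult_mono) simp_all
      moreover have "av (h y * ((z j - y j) + (w j - y j))) \<le> av (x0 i) * ?d"
        unfolding av_mult av_h[OF y] using av_add_le[OF zy[OF j] wy[OF j]] delta_pos by (intro mult_left_mono) simp_all
      ultimately have "av (y j * ((h z - h y) + (h w - h y)) - h y * ((z j - y j) + (w j - y j))) \<le> av (x0 i) * ?d"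
        by (rule av_diff_le)
      then show "av ((z j - w j) * (y j * ((h z - h y) + (h w - h y)) - h y * ((z j - y j) + (w j - y j)))) \<le> ?S * (av (x0 i) * ?d)"
        unfolding av_mult[of "z j - w j"] using av_le_sup_abs[OF j, of "\<lambda>j. z j - w j"] S
        by (intro mult_mono) simp_all
    qed (use S e delta_pos in simp)
    then have "av ?E * av (x0 i) * av (x0 i) \<le> (e * ?S) * av (x0 i) * av (x0 i)"
      unfolding av_mult near_sum[OF h_root(2)[OF z] h_root(2)[OF w]] av_h[OF y] by (simp add: mult_ac)
    then have Ele: "av ?E \<le> e * ?S" using delta_pos by simp
    show "sup_abs av r (\<lambda>l. param z l - param w l - (\<Sum>j<r - 1. jac y l j * (z j - w j))) \<le> e * ?S"
      unfolding sup_abs_le_iff[OF r1(2)]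
    proof (intro allI impI)
      fix l assume l: "l < r"
      show "av (param z l - param w l - (\<Sum>j<r - 1. jac y l j * (z j - w j))) \<le> e * ?S"
      proof (cases "l = i")
        case True
        then show ?thesis using Ele by (simp add: param_simps jac_def sum_negf)
      next
        case False
        define k' where "k' = delete_index i l"
        have k': "k' < r - 1" "l = insert_index i k'"
          using delete_index_less[OF i_less l False] insert_delete_index_neq[OF False] by (simp_all add: k'_def)
        have "(\<Sum>j<r - 1. jac y l j * (z j - w j)) = (\<Sum>j<r - 1. if j = k' then z j - w j else 0)"
          using False by (intro sum.cong refl) (auto simp: jac_def k'(2) insert_index_eq_iff)
        also have "\<dots> = z k' - w k'" using k'(1) by simp
        finally show ?thesis using S e k'(1) by (simp add: k'(2) param_simps)
      qed
    qed
  qed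
qed

text \<open>The gradient \<open>2 x\<close> is normal to the chart and has \<open>i\<close>-th coordinate \<open>2 h\<close>, of absolute value \<open>\<bar>x0\<^sub>i\<bar>\<close>.\<close>

lemma av_pullback:
  assumes y: "y \<in> V"
    and gauge: "\<epsilon> = 1 \<or> \<epsilon> = - 1"
      "(\<Sum>l<r. (- 1) ^ (r - 1 - l) * G l * (2 * param y l)) = \<epsilon>"
  shows "av (\<Sum>l<r. G l * minor r (jac y) l) = 1 / av (x0 i)"
proof -
  have "(\<Sum>l<r. 2 * param y l * jac y l j) = 0" if j: "j < r - 1" for j
  proof -
    have "(\<Sum>l<r. 2 * param y l * jac y l j)
      = 2 * h y * jac y i j + (\<Sum>k<r - 1. 2 * param y (insert_index i k) * jac y (insert_index i k) j)"
      by (subst sum_insert_index[OF i_less]) (simp add: param_simps)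
    also have "(\<Sum>k<r - 1. 2 * param y (insert_index i k) * jac y (insert_index i k) j)
      = (\<Sum>k<r - 1. if k = j then 2 * y k else 0)"
      by (rule sum.cong[OF refl]) (simp add: jac_def param_simps insert_index_exclude insert_index_eq_iff)
    also have "\<dots> = 2 * y j" using j by simp
    finally show ?thesis using h_nonzero[OF y] by (simp add: jac_def)
  qed
  then have "2 * param y i * (\<Sum>l<r. G l * minor r (jac y) l) = (- 1) ^ (r - 1 + i) * \<epsilon>"
    by (intro pullback_normal[where D = "jac y" and \<nu> = "\<lambda>l. 2 * param y l", OF i_less _ _ gauge(2)])
       (simp_all add: jac_def insert_index_exclude insert_index_eq_iff)
  then have "av (2 * param y i * (\<Sum>l<r. G l * minor r (jac y) l)) = av ((- 1) ^ (r - 1 + i) * \<epsilon>)"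
    by simp
  moreover have "av ((- 1) ^ (r - 1 + i) * \<epsilon>) = 1" using gauge(1) by (auto simp: av_mult av_power)
  ultimately show ?thesis
    using delta_pos by (simp add: av_mult av_2 param_simps av_h[OF y] field_simps)
qed

lemma is_chart_param: "is_chart av r (X_points r b) V param jac"
  unfolding is_chart_def
proof (intro conjI ballI)
  show "openin (affine_topology av (r - 1)) V" unfolding V_def by (rule openin_polydisc)
  show "openin (subtopology (affine_topology av r) (X_points r b)) (param ` V)"
    unfolding image_param openin_subtopology using openin_polydisc[of r k x0] by (metis Int_commute)
  show "homeomorphic_map (subtopology (affine_topology av (r - 1)) V)
     (subtopology (affine_topology av r) (param ` V)) param" by (rule homeomorphic_param)
  fix y assume y: "y \<in> V"
  show "strict_deriv av (r - 1) r V param y (jac y)" by (rule strict_deriv_param[OF y])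
  have "minor r (jac y) i = Determinant.det (1\<^sub>m (r - 1))"
    unfolding minor_def
    by (rule arg_cong[of _ _ Determinant.det], rule eq_matI)
       (auto simp: jac_def insert_index_exclude insert_index_eq_iff)
  then show "\<exists>l<r. minor r (jac y) l \<noteq> 0" using i_less by (intro exI[of _ i]) simp
qed

text \<open>The density \<open>1 / \<bar>x\<^sub>i\<bar>\<close> of the gauge form is constant on the chart, so the mass of the chart is this
  density times the volume of a whole polydisc.\<close>

lemma emeasure_X_polydisc:
  assumes haar: "is_haar av (r - 1) \<mu>"
    and form: "is_form_measure emb av r (X_points r b) g \<mu> m"
    and gauge: "\<And>x. x \<in> X_points r b \<Longrightarrow> \<exists>\<epsilon>. (\<epsilon> = 1 \<or> \<epsilon> = - 1) \<and>
      (\<Sum>l<r. (- 1) ^ (r - 1 - l) * meval emb (g l) x * (2 * x l)) = \<epsilon>"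
  shows "emeasure m (X_points r b \<inter> polydisc r k x0) = ennreal (1 / (real Q ^ (k * (r - 1)) * av (x0 i)))"
proof -
  have V: "V \<in> sets \<mu>" unfolding V_def by (rule haar_sets_polydisc[OF haar])
  have density: "av (pullback emb r g (param y) (jac y)) = 1 / av (x0 i)" if "y \<in> V" for y
  proof -
    have "param y \<in> X_points r b" using image_param that by blast
    from gauge[OF this] show ?thesis unfolding pullback_def by (elim exE conjE) (rule av_pullback[OF that])
  qed
  have "emeasure m (param ` V) = (\<integral>\<^sup>+ y \<in> V. ennreal (av (pullback emb r g (param y) (jac y))) \<partial>\<mu>)"
    using form is_chart_param V unfolding is_form_measure_def by blast
  also have "\<dots> = (\<integral>\<^sup>+ y. ennreal (1 / av (x0 i)) * indicator V y \<partial>\<mu>)"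
    by (intro nn_integral_cong) (simp add: indicator_def density)
  also have "\<dots> = ennreal (1 / av (x0 i)) * emeasure \<mu> V" by (rule nn_integral_cmult_indicator[OF V])
  also have "emeasure \<mu> V = ennreal (1 / real Q ^ (k * (r - 1)))"
    using haar_finite[OF haar subset_refl, of k "proj x0"] haar_measure_polydisc[OF haar, of k "proj x0"]
    by (simp add: V_def emeasure_eq_ennreal_measure)
  finally show ?thesis
    unfolding image_param by (simp flip: ennreal_mult add: mult.commute)
qed

end

section \<open>Comparison of the form measure with the volume of congruence sets\<close>

context odd_local_field
begin

text \<open>Polydiscs of one radius are equal or disjoint, and finitely many of them fill the integral points.\<close>

lemma finite_disjoint_cover:
  assumes "S \<subseteq> polydisc r 0 (\<lambda>_. 0)"
  obtains Z where "finite Z" "Z \<subseteq> S" "\<And>x. x \<in> S \<Longrightarrow> \<exists>z\<in>Z. x \<in> polydisc r K z" "disjoint_family_on (polydisc r K) Z"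
proof -
  obtain F where F: "finite F" "\<And>x. av x \<le> 1 \<Longrightarrow> \<exists>c\<in>F. av (x - c) \<le> av p ^ K"
    using finite_representatives by blast
  have SP: "x \<in> {..<r} \<rightarrow>\<^sub>E UNIV" if "x \<in> S" for x using that assms polydisc_subset by blast
  have "polydisc r K ` S \<subseteq> polydisc r K ` ({..<r} \<rightarrow>\<^sub>E F)"
  proof (rule image_subsetI)
    fix x assume x: "x \<in> S"
    then have "av (x i) \<le> 1" if "i < r" for i using assms that by (auto simp: integral_polydisc)
    then have "\<forall>i\<in>{..<r}. \<exists>c. c \<in> F \<and> av (x i - c) \<le> av p ^ K" using F(2) by blast
    then obtain c where c: "\<forall>i\<in>{..<r}. c i \<in> F \<and> av (x i - c i) \<le> av p ^ K" by (rule bchoice[THEN exE])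
    then have "x \<in> polydisc r K (restrict c {..<r})" using SP[OF x] by (simp add: polydisc_def)
    from polydisc_eq[OF this] have eq: "polydisc r K x = polydisc r K (restrict c {..<r})" .
    have "restrict c {..<r} \<in> {..<r} \<rightarrow>\<^sub>E F" using c by (simp add: restrict_PiE_iff)
    then show "polydisc r K x \<in> polydisc r K ` ({..<r} \<rightarrow>\<^sub>E F)"
      unfolding eq by (rule imageI)
  qed
  then have fin: "finite (polydisc r K ` S)"
    by (rule finite_subset) (intro finite_imageI finite_PiE finite_lessThan F(1))
  obtain Z where Z: "Z \<subseteq> S" "inj_on (polydisc r K) Z" "polydisc r K ` S = polydisc r K ` Z"
    using iffD1[OF subset_image_inj subset_refl[of "polydisc r K ` S"]] by (elim exE conjE)
  show ?thesis
  proof (rule that)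
    show "finite Z" using fin finite_imageD[OF _ Z(2)] Z(3) by simp
    show "Z \<subseteq> S" by fact
    show "\<exists>z\<in>Z. x \<in> polydisc r K z" if x: "x \<in> S" for x
    proof -
      have "polydisc r K x \<in> polydisc r K ` Z" using x Z(3) by blast
      then obtain z where "z \<in> Z" "polydisc r K x = polydisc r K z" by (rule imageE)
      then show ?thesis using polydisc_self[OF SP[OF x], of K] by (intro bexI[of _ z]) simp_all
    qed
    show "disjoint_family_on (polydisc r K) Z"
    proof (unfold disjoint_family_on_def, intro ballI impI, rule ccontr)
      fix z w assume zw: "z \<in> Z" "w \<in> Z" "z \<noteq> w" and "polydisc r K z \<inter> polydisc r K w \<noteq> {}"
      then obtain x where "x \<in> polydisc r K z" "x \<in> polydisc r K w" by blast
      then have "polydisc r K z = polydisc r K w" using polydisc_eq[of x r K z] polydisc_eq[of x r K w] by simp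
      then show False using zw Z(2) by (simp add: inj_on_def)
    qed
  qed
qed

text \<open>The congruence forces \<open>\<bar>f(y)\<bar> = \<bar>c\<bar>\<close>, so some coordinate of \<open>y\<close> is larger than \<open>\<bar>p\<bar>\<^sup>K\<close>, and modulo
  \<open>p\<^bsup>2K\<^esup>\<close> the congruence is fine enough to correct that coordinate.\<close>

lemma cong_solution_near_point:
  assumes r: "0 < r" and y: "y \<in> cong_solutions av p r j c" and K: "av p ^ K < av c" "2 * K \<le> j"
  obtains x where "x \<in> polydisc r 0 (\<lambda>_. 0)" "quad r x = c" "y \<in> polydisc r K x"
proof -
  have yO: "y \<in> polydisc r 0 (\<lambda>_. 0)" and q: "av (quad r y - c) \<le> av p ^ j"
    using y by (simp_all add: cong_solutions_eq)
  have yP: "y \<in> {..<r} \<rightarrow>\<^sub>E UNIV" and yi: "\<And>l. l < r \<Longrightarrow> av (y l) \<le> 1"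
    using yO by (simp_all add: integral_polydisc)
  have "av p ^ j \<le> av p ^ K" using K(2) by (intro p_pow_mono) simp
  then have "av (quad r y) = av c" using av_dominant[of "quad r y" c] q K(1) by linarith
  then have "av p ^ K < av (quad r y)" using K(1) by simp
  then obtain i s where i: "i < r" and s: "av (y i) = av p ^ s" "s < K"
    using integral_max_coordinate[OF r yO] by metis
  have "av p ^ j \<le> av p ^ (K + s)" using K(2) s(2) by (intro p_pow_mono) simp
  then have "av (quad r y - c) \<le> av p ^ K * av (y i)" using q by (simp add: power_add s(1))
  moreover have "av p ^ K < av (y i)" using s by (simp add: p_pow_less_iff)
  ultimately obtain u where u: "quad r (y(i := u)) = c" "av (u - y i) \<le> av p ^ K"
    using hensel_quad[OF i] by metis
  have near: "av (y l - (y(i := u)) l) \<le> av p ^ K" for l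
    using u(2) p_pow_pos[of K] by (simp add: av_commute[of "y i" u])
  show ?thesis
  proof (rule that[OF _ u(1)])
    show disc: "y \<in> polydisc r K (y(i := u))" using yP near unfolding polydisc_def by blast
    have "av ((u - y i) + y i) \<le> 1"
      using u(2) p_pow_mono[of 0 K] yi[OF i] by (intro av_add_le) simp_all
    then have "av ((y(i := u)) l) \<le> 1" if "l < r" for l using yi[OF that] by simp
    moreover have "y(i := u) \<in> {..<r} \<rightarrow>\<^sub>E UNIV" using PiE_arb[OF yP] i by (intro PiE_I) simp_all
    ultimately show "y(i := u) \<in> polydisc r 0 (\<lambda>_. 0)" by (simp add: integral_polydisc)
  qed
qed

lemma quad_scale: "quad r (\<lambda>i\<in>{..<r}. t * x i) = t\<^sup>2 * quad r x" for x :: "nat \<Rightarrow> 'f"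
  by (simp add: quad_def sum_distrib_left power_mult_distrib)

lemma polydisc_scale:
  assumes "n \<le> K" "x \<in> {..<r} \<rightarrow>\<^sub>E UNIV"
  shows "x \<in> polydisc r (K - n) (\<lambda>i\<in>{..<r}. z i / p ^ n) \<longleftrightarrow> (\<lambda>i\<in>{..<r}. p ^ n * x i) \<in> polydisc r K z"
proof -
  have "av (x i - z i / p ^ n) \<le> av p ^ (K - n) \<longleftrightarrow> av (p ^ n * x i - z i) \<le> av p ^ K" for i
  proof -
    have "p ^ n * x i - z i = p ^ n * (x i - z i / p ^ n)" by (simp add: algebra_simps)
    then have "av (p ^ n * x i - z i) = av p ^ n * av (x i - z i / p ^ n)"
      by (simp only: av_mult av_power)
    moreover have "av p ^ K = av p ^ n * av p ^ (K - n)" using assms(1) by (simp flip: power_add)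
    ultimately show ?thesis using p_pow_pos[of n] by simp
  qed
  then show ?thesis using assms(2) by (simp add: polydisc_def)
qed

text \<open>The substitution \<open>x = p\<^sup>-\<^sup>n x'\<close> takes integral points on \<open>f = c\<close> to the points of \<open>X\<close> with coordinates
  bounded by \<open>\<bar>p\<bar>\<^sup>-\<^sup>n\<close>.  It multiplies the radius and the coordinate \<open>x\<^sub>i\<close> in the mass of a chart by
  \<open>Q\<^sup>n\<close>, so that mass changes by \<open>Q\<^bsup>n(r-2)\<^esup>\<close>; this is the factor \<open>Q\<^bsup>nr+l\<^esup> / Q\<^bsup>2n+l\<^esup>\<close>.\<close>

theorem form_measure_eq_volume:
  assumes r: "2 \<le> r" and c: "c \<noteq> 0" and b: "b = c / p ^ (2 * n)"
    and haar_r: "is_haar av r \<mu>" and haar: "is_haar av (r - 1) \<mu>'"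
    and form: "is_form_measure emb av r (X_points r b) g \<mu>' m"
    and gauge: "\<And>x. x \<in> X_points r b \<Longrightarrow> \<exists>\<epsilon>. (\<epsilon> = 1 \<or> \<epsilon> = - 1) \<and>
      (\<Sum>l<r. (- 1) ^ (r - 1 - l) * meval emb (g l) x * (2 * x l)) = \<epsilon>"
    and S: "S = X_bounded_points av r b (1 / av p ^ n)"
  shows "emeasure m S < \<infinity>"
    and "\<exists>L. \<forall>l\<ge>L. real Q ^ (n * r + l) * measure \<mu> (cong_solutions av p r (2 * n + l) c) = measure m S"
proof -
  have r0: "0 < r" using r by simp
  obtain K0 where K0: "av p ^ K0 < av c"
    using real_arch_pow_inv[of "av c" "av p"] c p_less_1 by auto
  \<comment> \<open>\<open>K \<ge> n\<close> keeps the radius \<open>\<bar>p\<bar>\<^bsup>K-n\<^esup>\<close> of the rescaled polydiscs a natural power of \<open>\<bar>p\<bar>\<close>.\<close>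
  define K where "K = max n K0"
  have K: "n \<le> K" "av p ^ K < av c"
    using K0 p_pow_mono[of K0 K] by (simp_all add: K_def)
  define S' where "S' = {x \<in> polydisc r 0 (\<lambda>_. 0). quad r x = c}"
  have S'_sub: "S' \<subseteq> polydisc r 0 (\<lambda>_. 0)" by (auto simp: S'_def)
  obtain Z where Z: "finite Z" "Z \<subseteq> S'" "\<And>x. x \<in> S' \<Longrightarrow> \<exists>z\<in>Z. x \<in> polydisc r K z"
    "disjoint_family_on (polydisc r K) Z"
    using finite_disjoint_cover[OF S'_sub, of K] by metis
  have ZS: "z \<in> polydisc r 0 (\<lambda>_. 0)" "quad r z = c" if "z \<in> Z" for z
    using that Z(2) by (auto simp: S'_def)
  have Zi: "\<And>l. l < r \<Longrightarrow> av (z l) \<le> 1" if "z \<in> Z" for z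
    using ZS(1)[OF that] by (simp add: integral_polydisc)
  have "\<exists>s. s < K \<and> (\<exists>i<r. (\<forall>l<r. av (z l) \<le> av (z i)) \<and> av (z i) = av p ^ s)" if "z \<in> Z" for z
    using integral_max_coordinate[OF r0 ZS(1)[OF that], of K] ZS(2)[OF that] K(2) by metis
  then have "\<forall>z\<in>Z. \<exists>s. s < K \<and> (\<exists>i<r. (\<forall>l<r. av (z l) \<le> av (z i)) \<and> av (z i) = av p ^ s)" by blast
  then obtain s where "\<forall>z\<in>Z. s z < K \<and> (\<exists>i<r. (\<forall>l<r. av (z l) \<le> av (z i)) \<and> av (z i) = av p ^ s z)"
    by (rule bchoice[THEN exE])
  then have s_less: "\<And>z. z \<in> Z \<Longrightarrow> s z < K"
    and s: "\<And>z. z \<in> Z \<Longrightarrow> \<exists>i<r. (\<forall>l<r. av (z l) \<le> av (z i)) \<and> av (z i) = av p ^ s z" by blast+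
  define sc where "sc = (\<lambda>z. \<lambda>i\<in>{..<r}. z i / p ^ n)"
  define U where "U = (\<lambda>z. X_points r b \<inter> polydisc r (K - n) (sc z))"
  define M where "M = (\<lambda>z. 1 / (real Q ^ ((K - n) * (r - 1)) * (av p ^ s z / av p ^ n)))"
  have M_nonneg: "0 \<le> M z" for z unfolding M_def using p_pos by simp

  have em_U: "emeasure m (U z) = ennreal (M z)" if z: "z \<in> Z" for z
  proof -
    obtain i where i: "i < r" "\<And>l. l < r \<Longrightarrow> av (z l) \<le> av (z i)" "av (z i) = av p ^ s z"
      using s[OF z] by blast
    have sci: "av (sc z l) = av (z l) / av p ^ n" if "l < r" for l
      using that by (simp add: sc_def av_divide av_power)
    have "sc z = (\<lambda>l\<in>{..<r}. (1 / p ^ n) * z l)" by (simp add: sc_def)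
    then have "quad r (sc z) = b"
      by (simp only: quad_scale ZS(2)[OF z] b) (simp add: power_divide power_mult[symmetric] mult.commute)
    then have pt: "sc z \<in> X_points r b" by (simp add: X_points_def sc_def)
    have "av p ^ (K - n) * av p ^ n < av p ^ s z"
      using K(1) s_less[OF z] by (simp flip: power_add add: p_pow_less_iff)
    then have rad: "av p ^ (K - n) < av (sc z i)"
      using p_pow_pos[of n] by (simp add: sci[OF i(1)] i(3) field_simps)
    interpret quadric_chart av p Q R r i "K - n" "sc z" b
      by unfold_locales
         (use r i(1) pt rad i(2) in \<open>simp_all add: sci divide_right_mono\<close>)
    show ?thesis
      using emeasure_X_polydisc[OF haar form gauge] by (simp add: U_def M_def sci[OF i(1)] i(3))
  qed
  have U_iff: "x \<in> U z \<longleftrightarrow> x \<in> X_points r b \<and> (\<lambda>i\<in>{..<r}. p ^ n * x i) \<in> polydisc r K z" for x z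
    using polydisc_scale[OF K(1), of x r z] by (auto simp: U_def sc_def X_points_def)
  have S_eq: "S = (\<Union>z\<in>Z. U z)"
  proof (intro equalityI subsetI)
    fix x assume "x \<in> S"
    then have X: "x \<in> X_points r b" and xi: "\<And>l. l < r \<Longrightarrow> av (x l) \<le> 1 / av p ^ n"
      by (simp_all add: S X_bounded_points_def)
    define x' where "x' = (\<lambda>i\<in>{..<r}. p ^ n * x i)"
    have "quad r x' = (p ^ n)\<^sup>2 * b" unfolding x'_def quad_scale using X by (simp add: X_points_def)
    also have "\<dots> = c" unfolding b by (simp add: power_mult[symmetric] mult.commute)
    finally have "quad r x' = c" .
    moreover have "av (x' l) \<le> 1" if "l < r" for l
      using xi[OF that] that p_pow_pos[of n] by (simp add: x'_def av_mult av_power field_simps)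
    ultimately have "x' \<in> S'" by (simp add: S'_def integral_polydisc x'_def)
    then obtain z where "z \<in> Z" "x' \<in> polydisc r K z" using Z(3) by blast
    then show "x \<in> (\<Union>z\<in>Z. U z)" using X unfolding x'_def by (intro UN_I[of z]) (simp_all only: U_iff simp_thms)
  next
    fix x assume "x \<in> (\<Union>z\<in>Z. U z)"
    then obtain z where z: "z \<in> Z" "x \<in> U z" by blast
    then have X: "x \<in> X_points r b" and d: "(\<lambda>i\<in>{..<r}. p ^ n * x i) \<in> polydisc r K z" by (simp_all add: U_iff)
    have "av (x l) \<le> 1 / av p ^ n" if l: "l < r" for l
    proof -
      have "av (p ^ n * x l - z l) \<le> 1"
        using d l p_pow_mono[of 0 K] by (force simp: polydisc_def)
      then have "av ((p ^ n * x l - z l) + z l) \<le> 1" using Zi[OF z(1) l] by (rule av_add_le)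
      then show ?thesis using p_pow_pos[of n] by (simp add: av_mult av_power field_simps)
    qed
    then show "x \<in> S" using X by (simp add: S X_bounded_points_def)
  qed
  have U_disj: "disjoint_family_on U Z"
  proof (unfold disjoint_family_on_def, intro ballI impI, rule ccontr)
    fix z w assume zw: "z \<in> Z" "w \<in> Z" "z \<noteq> w" and "U z \<inter> U w \<noteq> {}"
    then obtain x where "x \<in> U z" "x \<in> U w" by blast
    then have "polydisc r K z \<inter> polydisc r K w \<noteq> {}" unfolding U_iff by blast
    then show False using Z(4) zw unfolding disjoint_family_on_def by blast
  qed
  have U_sets: "U ` Z \<subseteq> sets m"
  proof (rule image_subsetI)
    fix z assume "z \<in> Z"
    have "openin (subtopology (affine_topology av r) (X_points r b)) (U z)"
      unfolding U_def openin_subtopology using openin_polydisc[of r "K - n" "sc z"] by (metis Int_commute)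
    moreover have "sets m = sets (borel_of (subtopology (affine_topology av r) (X_points r b)))"
      using form by (simp add: is_form_measure_def)
    ultimately show "U z \<in> sets m" by (simp add: sets_borel_of)
  qed
  have "emeasure m S = (\<Sum>z\<in>Z. emeasure m (U z))"
    unfolding S_eq by (rule sum_emeasure[OF U_sets U_disj Z(1), symmetric])
  also have "\<dots> = (\<Sum>z\<in>Z. ennreal (M z))" by (rule sum.cong[OF refl]) (rule em_U)
  also have "\<dots> = ennreal (\<Sum>z\<in>Z. M z)" by (rule sum_ennreal) (rule M_nonneg)
  finally have em_S: "emeasure m S = ennreal (\<Sum>z\<in>Z. M z)" .
  then show "emeasure m S < \<infinity>" by simp
  have m_S: "measure m S = (\<Sum>z\<in>Z. M z)"
    unfolding measure_def em_S by (rule enn2real_ennreal) (intro sum_nonneg M_nonneg)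

  show "\<exists>L. \<forall>l\<ge>L. real Q ^ (n * r + l) * measure \<mu> (cong_solutions av p r (2 * n + l) c) = measure m S"
  proof (intro exI[of _ "2 * K"] allI impI)
    fix l assume l: "2 * K \<le> l"
    define j where "j = 2 * n + l"
    let ?T = "cong_solutions av p r j c"
    define A where "A = (\<lambda>z. {y \<in> polydisc r K z. av (quad r y - c) \<le> av p ^ j})"
    have jK: "2 * K \<le> j" using l by (simp add: j_def)
    have A_eq: "A z = ?T \<inter> polydisc r K z" if "z \<in> Z" for z
    proof -
      have "polydisc r K z \<subseteq> polydisc r 0 (\<lambda>_. 0)"
        using polydisc_mono[of 0 K r z] polydisc_eq[OF ZS(1)[OF that]] by simp
      then show ?thesis unfolding A_def cong_solutions_eq by blast
    qed
    have T_sets: "?T \<in> sets \<mu>"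
    proof (rule haar_sets_stable[OF haar_r, where k = j])
      show "?T \<subseteq> {..<r} \<rightarrow>\<^sub>E UNIV" unfolding cong_solutions_eq using polydisc_subset by blast
    qed (rule polydisc_subset_cong_solutions[OF _ order_refl])
    have A_sets: "A ` Z \<subseteq> sets \<mu>"
      by (rule image_subsetI) (simp only: A_eq sets.Int[OF T_sets haar_sets_polydisc[OF haar_r]])
    have A_disj: "disjoint_family_on A Z"
      using Z(4) unfolding disjoint_family_on_def A_def by blast
    have T_eq: "?T = (\<Union>z\<in>Z. A z)"
    proof (intro equalityI subsetI)
      fix y assume y: "y \<in> ?T"
      obtain x where x: "x \<in> polydisc r 0 (\<lambda>_. 0)" "quad r x = c" "y \<in> polydisc r K x"
        by (rule cong_solution_near_point[OF r0 y K(2) jK])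
      then obtain z where z: "z \<in> Z" "x \<in> polydisc r K z" using Z(3)[of x] by (auto simp: S'_def)
      then have "y \<in> A z" using A_eq[OF z(1)] y x(3) polydisc_trans[OF z(2)] by blast
      then show "y \<in> (\<Union>z\<in>Z. A z)" using z(1) by blast
    next
      fix y assume "y \<in> (\<Union>z\<in>Z. A z)"
      then obtain z where "z \<in> Z" "y \<in> A z" by blast
      then show "y \<in> ?T" using A_eq by blast
    qed
    have "measure \<mu> ?T = (\<Sum>z\<in>Z. measure \<mu> (A z))"
      unfolding T_eq
    proof (rule measure_finite_Union[OF Z(1) A_sets A_disj])
      fix z
      have "A z \<subseteq> polydisc r K z" by (auto simp: A_def)
      then show "emeasure \<mu> (A z) \<noteq> \<infinity>" by (rule haar_finite[OF haar_r])
    qed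
    moreover have "real Q ^ (n * r + l) * measure \<mu> (A z) = M z" if z: "z \<in> Z" for z
    proof -
      obtain i where i: "i < r" "\<And>l. l < r \<Longrightarrow> av (z l) \<le> av (z i)" "av (z i) = av p ^ s z"
        using s[OF z] by blast
      obtain t where t: "j = K + s z + t" using jK s_less[OF z] le_Suc_ex[of "K + s z" j] by auto
      have "z \<in> cong_solutions av p r (K + s z) c"
        using ZS[OF z] p_pow_pos by (simp add: cong_solutions_eq less_imp_le)
      then have "real Q ^ t * measure \<mu> (A z) = 1 / real Q ^ (K * r)"
        unfolding A_def t
        by (intro measure_cong_solutions_polydisc[where x = z and i = i and s = "s z", OF haar_r _ i(1) i(3)]
              s_less[OF z] i(2))
      then have mA: "measure \<mu> (A z) = 1 / (real Q ^ t * real Q ^ (K * r))"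
        using Q_ge_2 by (simp add: field_simps)
      \<comment> \<open>Without truncated subtraction the exponents on both sides agree.\<close>
      obtain d where d: "K = n + d" using K(1) le_Suc_ex by blast
      obtain r' where r': "r = Suc r'" using r0 gr0_implies_Suc by blast
      have "(n * r + l) + ((K - n) * (r - 1) + n) = s z + (t + K * r)"
        using t unfolding j_def d r' by (simp add: algebra_simps)
      then have "real Q ^ (n * r + l) * (real Q ^ ((K - n) * (r - 1)) * real Q ^ n)
         = real Q ^ s z * (real Q ^ t * real Q ^ (K * r))"
        by (simp only: power_add[symmetric])
      then show ?thesis
        using Q_ge_2 unfolding mA M_def av_p by (simp add: field_simps)
    qed
    ultimately show "real Q ^ (n * r + l) * measure \<mu> (cong_solutions av p r (2 * n + l) c) = measure m S"
      unfolding m_S j_def[symmetric] by (simp add: sum_distrib_left)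
  qed
qed

end

section \<open>Completions of the rational function field are local fields\<close>

text \<open>Polynomials of degree below \<open>n\<close>, in a form that makes \<open>n = 0\<close> meaningful.\<close>

definition polys_below :: "nat \<Rightarrow> 'k :: {field, finite} poly set" where
  "polys_below n = {P. \<forall>i\<ge>n. coeff P i = 0}"

lemma card_polys_below: "finite (polys_below n :: 'k :: {field, finite} poly set)
    \<and> card (polys_below n :: 'k poly set) = CARD('k) ^ n"
proof (induction n)
  case 0
  have "polys_below 0 = {0 :: 'k poly}" by (auto simp: polys_below_def poly_eq_iff)
  then show ?case by simp
next
  case (Suc n)
  have "polys_below (Suc n) = (\<lambda>(a, P). pCons a P) ` (UNIV \<times> polys_below n :: ('k \<times> 'k poly) set)"
  proof (intro equalityI subsetI)
    fix P :: "'k poly" assume P: "P \<in> polys_below (Suc n)"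
    obtain a P' where P': "P = pCons a P'" by (cases P) auto
    have "coeff P' i = 0" if "n \<le> i" for i
    proof -
      have "coeff P (Suc i) = 0" using P that by (simp add: polys_below_def)
      then show ?thesis by (simp add: P')
    qed
    then show "P \<in> (\<lambda>(a, P). pCons a P) ` (UNIV \<times> polys_below n)"
      unfolding P' by (intro image_eqI[where x = "(a, P')"]) (simp_all add: polys_below_def)
  next
    fix P :: "'k poly" assume "P \<in> (\<lambda>(a, P). pCons a P) ` (UNIV \<times> polys_below n)"
    then obtain a P' where P': "P = pCons a P'" "P' \<in> polys_below n" by auto
    have "coeff P i = 0" if "Suc n \<le> i" for i
      using that P'(2) unfolding P'(1) by (cases i) (simp_all add: polys_below_def)
    then show "P \<in> polys_below (Suc n)" by (simp add: polys_below_def)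
  qed
  moreover have "inj_on (\<lambda>(a, P). pCons a P) (UNIV \<times> polys_below n :: ('k \<times> 'k poly) set)"
    by (auto simp: inj_on_def)
  ultimately show ?case using Suc by (simp add: card_image card_cartesian_product)
qed

lemma polys_below_diff: "P \<in> polys_below n \<Longrightarrow> P' \<in> polys_below n \<Longrightarrow> P - P' \<in> polys_below n"
  by (simp add: polys_below_def)

lemma degree_polys_below: "P \<in> polys_below n \<Longrightarrow> P \<noteq> 0 \<Longrightarrow> degree P < n"
  by (rule ccontr) (auto simp: polys_below_def leading_coeff_0_iff not_less)

lemma mod_polys_below: "0 < degree p \<Longrightarrow> P mod p \<in> polys_below (degree p)"
  using degree_mod_less[of p P] by (cases "p = 0") (auto simp: polys_below_def intro: coeff_eq_0)

lemma place_degree_pos: "is_place v \<Longrightarrow> 0 < place_degree v"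
  for v :: "'k :: {field, finite} poly place"
  by (cases v) (auto intro!: gr0I simp: irreducible_def is_unit_iff_degree)

text \<open>The exponent in the absolute value at \<open>p\<close>.\<close>

definition poly_multiplicity :: "'k :: field poly \<Rightarrow> 'k poly \<Rightarrow> nat" where
  "poly_multiplicity p P = Max {n. p ^ n dvd P}"

lemma power_dvd_iff_poly_multiplicity:
  fixes p P :: "'k :: field poly"
  assumes "0 < degree p" "P \<noteq> 0"
  shows "p ^ n dvd P \<longleftrightarrow> n \<le> poly_multiplicity p P"
proof -
  let ?S = "{n. p ^ n dvd P}"
  have "n \<le> degree P" if "p ^ n dvd P" for n
  proof -
    have "n * degree p \<le> degree P"
      using dvd_imp_degree_le[OF that assms(2)] assms(1) by (subst (asm) degree_power_eq) auto
    moreover have "n \<le> n * degree p" using assms(1) by (cases "degree p") simp_all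
    ultimately show ?thesis by linarith
  qed
  then have fin: "finite ?S" by (intro finite_subset[of ?S "{..degree P}"]) auto
  have "0 \<in> ?S" by simp
  then have "?S \<noteq> {}" by (rule ex_in_conv[THEN iffD1, OF exI])
  with fin have "poly_multiplicity p P \<in> ?S" unfolding poly_multiplicity_def by (rule Max_in)
  then show ?thesis
    using Max_ge[OF fin, of n] dvd_trans[OF le_imp_power_dvd[of n "poly_multiplicity p P" p]]
    by (auto simp: poly_multiplicity_def)
qed

lemma place_abs_finite:
  fixes p P :: "'k :: {field, finite} poly"
  assumes "P \<noteq> 0"
  shows "place_abs (Finite_place p) P = inverse (real CARD('k) ^ (degree p * poly_multiplicity p P))"
  using assms by (simp add: poly_multiplicity_def)

lemma place_abs_pos: "is_place v \<Longrightarrow> P \<noteq> 0 \<Longrightarrow> 0 < place_abs v P"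
  for v :: "'k :: {field, finite} poly place"
  by (cases v) (simp_all add: place_abs_finite del: place_abs.simps(2))

lemma place_abs_polys_below:
  fixes v :: "'k :: {field, finite} poly place"
  assumes "is_place v" "P \<in> polys_below (place_degree v)" "P \<noteq> 0"
  shows "place_abs v P = 1"
proof (cases v)
  case Infinite_place
  then show ?thesis using degree_polys_below[OF assms(2,3)] assms(3) by simp
next
  case (Finite_place p)
  then have p: "irreducible p" using assms(1) by simp
  have "degree P < degree p" using degree_polys_below[OF assms(2,3)] Finite_place by simp
  then have "\<not> p dvd P" using dvd_imp_degree_le[of p P] assms(3) by auto
  then have "poly_multiplicity p P = 0"
    using power_dvd_iff_poly_multiplicity[of p P 1] place_degree_pos[OF assms(1)] assms(3) Finite_place by simp
  then show ?thesis unfolding Finite_place using place_abs_finite[OF assms(3), of p] by simp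
qed

lemma place_abs_powi:
  fixes v :: "'k :: {field, finite} poly place"
  assumes "is_place v" "P \<noteq> 0"
  shows "\<exists>e::int. place_abs v P = (1 / real (CARD('k) ^ place_degree v)) powi e"
proof (cases v)
  case Infinite_place
  then show ?thesis using assms(2)
    by (intro exI[of _ "- int (degree P)"]) (simp add: power_int_minus power_divide)
next
  case (Finite_place p)
  then show ?thesis using place_abs_finite[of P p] assms
    by (intro exI[of _ "int (poly_multiplicity p P)"])
       (simp add: power_divide power_mult[symmetric] inverse_eq_divide del: place_abs.simps)
qed

text \<open>Integral elements of the function field have representatives of degree below that of the place: at
  infinity the quotient of the coefficients at the degree of the denominator, at \<open>p\<close> a solution of a linear congruence, since
  multiplication by an element prime to \<open>p\<close> permutes the finite set of residues.\<close>

lemma integral_fraction_residue: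
  fixes v :: "'k :: {field, finite} poly place"
  assumes v: "is_place v" and D: "D \<noteq> 0" and le: "place_abs v P \<le> place_abs v D"
  shows "\<exists>C \<in> polys_below (place_degree v).
     place_abs v (P - C * D) \<le> place_abs v D / real (CARD('k) ^ place_degree v)"
proof (cases v)
  case Infinite_place
  have q: "1 < real CARD('k)"
    using card_mono[of "UNIV :: 'k set" "{0, 1}"] by simp
  have degP: "degree P \<le> degree D"
    using le D q Infinite_place by (cases "P = 0") (simp_all add: power_increasing_iff)
  define c where "c = coeff P (degree D) / lead_coeff D"
  have "place_abs v (P - [:c:] * D) \<le> place_abs v D / real CARD('k)"
  proof (cases "P - [:c:] * D = 0")
    case True
    then show ?thesis using place_abs_pos[OF v D] by (simp add: Infinite_place)
  next
    case False
    have "coeff (P - [:c:] * D) i = 0" if "degree D \<le> i" for i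
      using that degP D by (cases "i = degree D") (simp_all add: c_def coeff_eq_0)
    then have "degree (P - [:c:] * D) < degree D"
      using degree_polys_below[OF _ False, of "degree D"] by (simp add: polys_below_def)
    then have "real CARD('k) ^ Suc (degree (P - [:c:] * D)) \<le> real CARD('k) ^ degree D"
      using q by (intro power_increasing) simp_all
    then show ?thesis using False D q by (simp add: Infinite_place field_simps)
  qed
  moreover have "[:c:] \<in> polys_below (place_degree v)"
    using Infinite_place by (simp add: polys_below_def coeff_pCons split: nat.split)
  ultimately show ?thesis using Infinite_place by (intro bexI[of _ "[:c:]"]) simp_all
next
  case (Finite_place p)
  then have p: "irreducible p" using v by simp
  then have prime: "prime_elem p" by (rule field_poly_irreducible_imp_prime)
  have deg: "0 < degree p" using place_degree_pos[OF v] Finite_place by simp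
  have q: "0 < real CARD('k)" by simp
  have q1: "1 < real CARD('k)"
    using card_mono[of "UNIV :: 'k set" "{0, 1}"] by simp
  have pa: "place_abs v X = inverse (real CARD('k) ^ (degree p * poly_multiplicity p X))" if "X \<noteq> 0" for X
    unfolding Finite_place by (rule place_abs_finite[OF that])
  let ?B = "polys_below (degree p) :: 'k poly set"
  define e where "e = poly_multiplicity p D"
  have "p ^ e dvd D" using power_dvd_iff_poly_multiplicity[OF deg D] by (simp add: e_def)
  then obtain D1 where D1_eq: "D = p ^ e * D1" by (rule dvdE)
  have D1_ndvd: "\<not> p dvd D1"
  proof
    assume "p dvd D1"
    then have "p ^ Suc e dvd D" unfolding D1_eq by (simp add: mult.commute mult_dvd_mono)
    then show False using power_dvd_iff_poly_multiplicity[OF deg D, of "Suc e"] by (simp add: e_def)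
  qed
  note D1 = D1_eq D1_ndvd
  have dvdP: "p ^ e dvd P"
  proof (cases "P = 0")
    case False
    have "real CARD('k) ^ (degree p * e) \<le> real CARD('k) ^ (degree p * poly_multiplicity p P)"
      using le q unfolding pa[OF False] pa[OF D] e_def by simp
    then have "e \<le> poly_multiplicity p P" using q1 deg by (simp add: power_increasing_iff)
    then show ?thesis using power_dvd_iff_poly_multiplicity[OF deg False] by simp
  qed simp
  then obtain N where N: "P = p ^ e * N" by (rule dvdE)
  have "inj_on (\<lambda>C. (C * D1) mod p) ?B"
  proof (rule inj_onI)
    fix C C' assume C: "C \<in> ?B" "C' \<in> ?B" and "(C * D1) mod p = (C' * D1) mod p"
    then have "p dvd (C - C') * D1" by (simp add: mod_eq_dvd_iff left_diff_distrib)
    then have "p dvd C - C'" using prime_elem_dvd_multD[OF prime] D1(2) by blast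
    then show "C = C'"
      using degree_polys_below[OF polys_below_diff[OF C]] dvd_imp_degree_le[of p "C - C'"] by force
  qed
  moreover have "(\<lambda>C. (C * D1) mod p) ` ?B \<subseteq> ?B"
    by (rule image_subsetI) (rule mod_polys_below[OF deg])
  ultimately have "(\<lambda>C. (C * D1) mod p) ` ?B = ?B"
    using card_polys_below by (intro endo_inj_surj) blast+
  then have "N mod p \<in> (\<lambda>C. (C * D1) mod p) ` ?B"
    using mod_polys_below[OF deg] by simp
  then obtain C where C: "N mod p = (C * D1) mod p" "C \<in> ?B" by (rule imageE)
  then have "p dvd N - C * D1" by (simp add: mod_eq_dvd_iff)
  then obtain W where W: "N - C * D1 = p * W" by (rule dvdE)
  have eq: "P - C * D = p ^ Suc e * W"
    using W unfolding N D1(1) by (simp add: algebra_simps)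
  have "place_abs v (P - C * D) \<le> place_abs v D / real (CARD('k) ^ place_degree v)"
  proof (cases "P - C * D = 0")
    case True
    then show ?thesis using place_abs_pos[OF v D] by (simp add: Finite_place)
  next
    case False
    have "p ^ Suc e dvd P - C * D" unfolding eq by simp
    then have "Suc e \<le> poly_multiplicity p (P - C * D)"
      using power_dvd_iff_poly_multiplicity[OF deg False, of "Suc e"] by simp
    then have "degree p * e + degree p \<le> degree p * poly_multiplicity p (P - C * D)"
      using mult_le_mono2[of "Suc e" "poly_multiplicity p (P - C * D)" "degree p"] by simp
    then have "real CARD('k) ^ (degree p * e) * real CARD('k) ^ degree p
       \<le> real CARD('k) ^ (degree p * poly_multiplicity p (P - C * D))"
      unfolding power_add[symmetric] using q1 by (intro power_increasing) simp_all
    then show ?thesis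
      unfolding pa[OF False] pa[OF D] e_def[symmetric] using q
      by (simp add: Finite_place field_simps)
  qed
  then show ?thesis using C(2) by (intro bexI[of _ C]) (simp_all add: Finite_place)
qed

text \<open>If \<open>2 = 0\<close>, the pairs \<open>{x, x + 1}\<close> partition the field.\<close>

lemma two_nonzero_if_odd_card:
  assumes "odd CARD('k :: {field, finite})"
  shows "(2 :: 'k) \<noteq> 0"
proof
  assume "(2 :: 'k) = 0"
  then have two: "x + 1 + 1 = x" for x :: 'k by (simp add: add.assoc)
  let ?C = "range (\<lambda>x :: 'k. {x, x + 1})"
  have "2 dvd card (\<Union>?C)"
  proof (rule dvd_partition)
    show "finite (\<Union>?C)" by (rule finite)
    show "\<forall>c\<in>?C. 2 dvd card c" by simp
    show "\<forall>c1\<in>?C. \<forall>c2\<in>?C. c1 \<noteq> c2 \<longrightarrow> c1 \<inter> c2 = {}" using two by auto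
  qed
  moreover have "\<Union>?C = UNIV" by auto
  ultimately show False using assms by simp
qed

context place_completion
begin

lemma emb_0: "emb 0 = 0"
proof -
  have "emb 0 + emb 0 = emb 0 + 0" by (simp flip: emb_add)
  then show ?thesis by (simp only: add_left_cancel)
qed

lemma emb_diff: "emb (x - y) = emb x - emb y"
  using emb_add[of "x - y" y] by simp

lemma emb_divide: "emb (x / y) = emb x / emb y"
proof (cases "y = 0")
  case False
  then have "emb (x / y) * emb y = emb x" by (simp flip: emb_mult)
  moreover have "emb y \<noteq> 0"
  proof
    assume "emb y = 0"
    then have "emb (inverse y * y) = 0" by (simp only: emb_mult) simp
    then show False using False emb_one by simp
  qed
  ultimately show ?thesis by (simp add: field_simps)
qed (simp add: emb_0)

lemma emb_inverse: "emb (inverse x) = inverse (emb x)"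
  using emb_divide[of 1 x] by (simp add: emb_one inverse_eq_divide)

lemma emb_power: "emb (x ^ n) = emb x ^ n"
  by (induction n) (simp_all add: emb_one emb_mult)

sublocale ultrametric_abs av
  by unfold_locales (rule av_nonneg av_eq_0_iff av_mult av_ultrametric)+

lemma place_abs_1: "is_place v \<Longrightarrow> place_abs v 1 = 1"
  using place_abs_polys_below[of v 1] place_degree_pos[of v]
  by (simp add: polys_below_def)

lemma av_emb_poly: "is_place v \<Longrightarrow> av (emb (to_fract P)) = place_abs v P"
  using av_emb[of 1 P] by (simp add: to_fract_def place_abs_1)

lemma approx:
  assumes "0 < e"
  obtains P D where "D \<noteq> 0" "av (x - emb (Fract P D)) < e"
proof -
  have "x \<in> abs_topology av closure_of range emb" using dense by simp
  then obtain y where y: "av (x - emb y) < e"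
    unfolding abs_topology_eq M.metric_closure_of using assms by (auto simp: abs_dist_def)
  obtain P D where "y = Fract P D" "D \<noteq> 0" by (rule Fract_cases)
  then show ?thesis using that y by blast
qed

text \<open>Every property that involves only an approximation of the element holds because it holds in the
  function field, which is dense.\<close>

lemma completion_is_local_field:
  assumes v: "is_place v" and odd: "odd CARD('k)"
  shows "odd_local_field av (emb (uniformizer v)) (CARD('k) ^ place_degree v)
     ((\<lambda>P. emb (to_fract P)) ` polys_below (place_degree v))"
proof -
  define d where "d = place_degree v"
  define Q where "Q = CARD('k) ^ d"
  have d: "0 < d" using place_degree_pos[OF v] by (simp add: d_def)
  have q: "2 \<le> CARD('k)" using card_mono[of "UNIV :: 'k set" "{0, 1}"] by simp
  have Q: "2 \<le> Q" using q d self_le_power[of "CARD('k)" d] by (simp add: Q_def)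
  have av_p: "av (emb (uniformizer v)) = 1 / real Q"
  proof (cases v)
    case Infinite_place
    have "av (emb (inverse tvar)) = 1 / av (emb tvar)"
      unfolding inverse_eq_divide emb_divide emb_one av_divide by simp
    also have "av (emb tvar) = real CARD('k)"
      unfolding tvar_def av_emb_poly[OF v] by (simp add: Infinite_place)
    finally show ?thesis by (simp add: Infinite_place Q_def d_def)
  next
    case (Finite_place p)
    then have p: "irreducible p" using v by simp
    then have "p \<noteq> 0" by auto
    have deg: "0 < degree p" using d by (simp add: d_def Finite_place)
    have "1 \<le> poly_multiplicity p p" using power_dvd_iff_poly_multiplicity[OF deg \<open>p \<noteq> 0\<close>, of 1] by simp
    moreover have "\<not> p ^ 2 dvd p"
      using dvd_imp_degree_le[of "p ^ 2" p] \<open>p \<noteq> 0\<close> deg by (auto simp: power2_eq_square degree_mult_eq)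
    then have "\<not> 2 \<le> poly_multiplicity p p" using power_dvd_iff_poly_multiplicity[OF deg \<open>p \<noteq> 0\<close>] by blast
    ultimately have self: "poly_multiplicity p p = 1" by linarith
    then have "place_abs v p = inverse (real CARD('k) ^ degree p)"
      unfolding Finite_place place_abs_finite[OF \<open>p \<noteq> 0\<close>] using self by simp
    then show ?thesis using av_emb_poly[OF v, of p] by (simp add: Finite_place Q_def d_def inverse_eq_divide)
  qed
  have near: "av (emb (to_fract C - to_fract C')) = 1"
    if "C \<in> polys_below d" "C' \<in> polys_below d" "C \<noteq> C'" for C C'
  proof -
    have "to_fract C - to_fract C' = to_fract (C - C')" by simp
    then show ?thesis
      using place_abs_polys_below[OF v, of "C - C'"] polys_below_diff[OF that(1,2)] that(3)
      by (simp only: av_emb_poly[OF v]) (simp add: d_def)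
  qed
  have inj: "inj_on (\<lambda>P. emb (to_fract P)) (polys_below d)"
  proof (rule inj_onI, rule ccontr)
    fix C C' assume C: "C \<in> polys_below d" "C' \<in> polys_below d" "C \<noteq> C'"
      and eq: "emb (to_fract C) = emb (to_fract C')"
    then show False using near[OF C] by (simp add: emb_diff)
  qed
  have av_frac: "av (emb (Fract P D)) = place_abs v P / place_abs v D" if "D \<noteq> 0" for P D
    by (rule av_emb[OF that])
  have "odd_local_field av (emb (uniformizer v)) Q ((\<lambda>P. emb (to_fract P)) ` polys_below d)"
  proof unfold_locales
    show "M.mcomplete" by (rule complete)
    have "[:2:] \<in> polys_below d" using d by (simp add: polys_below_def coeff_pCons split: nat.split)
    then have "av (emb (to_fract [:2:])) = 1"
      using two_nonzero_if_odd_card[OF odd] place_abs_polys_below[OF v, of "[:2:]"]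
      by (simp add: av_emb_poly[OF v] d_def)
    moreover have "emb (to_fract [:2:]) = 2"
    proof -
      have "[:2:] = 1 + (1 :: 'k poly)" by (simp add: one_pCons)
      then have "to_fract [:2:] = 1 + (1 :: 'k poly fract)" by (simp only: to_fract_add to_fract_1)
      then have "emb (to_fract [:2:]) = 1 + 1" by (simp only: emb_add emb_one)
      then show ?thesis by simp
    qed
    ultimately show "av 2 = 1" by simp
    show "2 \<le> Q" by (rule Q)
    show "av (emb (uniformizer v)) = 1 / real Q" by (rule av_p)
    show "finite ((\<lambda>P. emb (to_fract P)) ` polys_below d)"
      using card_polys_below by blast
    show "card ((\<lambda>P. emb (to_fract P)) ` polys_below d) = Q"
      using card_image[OF inj] card_polys_below[where ?'k = 'k, of d] by (simp add: Q_def)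
  next
    fix c assume "c \<in> (\<lambda>P. emb (to_fract P)) ` polys_below d"
    then obtain C where "C \<in> polys_below d" "c = emb (to_fract C)" by (rule imageE)
    then show "av c \<le> 1"
      using place_abs_polys_below[OF v, of C]
      by (cases "C = 0") (simp_all add: av_emb_poly[OF v] d_def emb_0 del: place_abs.simps)
  next
    fix c c' assume "c \<in> (\<lambda>P. emb (to_fract P)) ` polys_below d" "c' \<in> (\<lambda>P. emb (to_fract P)) ` polys_below d"
      and le: "av (c - c') \<le> av (emb (uniformizer v))"
    then obtain C C' where C: "C \<in> polys_below d" "c = emb (to_fract C)" "C' \<in> polys_below d" "c' = emb (to_fract C')"
      by (elim imageE)
    show "c = c'"
    proof (rule ccontr)
      assume "c \<noteq> c'"
      then have "C \<noteq> C'" using C by auto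
      from near[OF C(1,3) this] have "av (c - c') = 1" by (simp only: C emb_diff)
      then show False using le Q unfolding av_p by simp
    qed
  next
    fix x assume x: "av x \<le> 1"
    have "0 < 1 / real Q" using Q by simp
    then obtain P D where D: "D \<noteq> 0" and y: "av (x - emb (Fract P D)) < 1 / real Q" by (rule approx)
    have "1 / real Q \<le> 1" using Q by simp
    then have "av (emb (Fract P D) - x) \<le> 1" using y by (simp add: av_commute[of _ x])
    then have "av ((emb (Fract P D) - x) + x) \<le> 1" using x by (rule av_add_le)
    then have "place_abs v P \<le> place_abs v D"
      using place_abs_pos[OF v D] by (simp add: av_frac[OF D] field_simps)
    then obtain C where C: "C \<in> polys_below d" "place_abs v (P - C * D) \<le> place_abs v D / real Q"
      using integral_fraction_residue[OF v D] unfolding d_def Q_def by blast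
    have "Fract P D - to_fract C = Fract (P - C * D) D" using D by (simp add: to_fract_def)
    then have "av (emb (Fract P D) - emb (to_fract C)) = place_abs v (P - C * D) / place_abs v D"
      by (simp only: emb_diff[symmetric] av_frac[OF D])
    also have "\<dots> \<le> 1 / real Q" using C(2) place_abs_pos[OF v D] by (simp add: field_simps)
    finally have le_C: "av (emb (Fract P D) - emb (to_fract C)) \<le> 1 / real Q" .
    have "av (x - emb (to_fract C)) \<le> av (emb (uniformizer v))"
      unfolding av_p by (rule av_diff_trans[OF less_imp_le[OF y] le_C])
    then show "\<exists>c\<in>(\<lambda>P. emb (to_fract P)) ` polys_below d. av (x - c) \<le> av (emb (uniformizer v))"
      by (rule bexI) (rule imageI[OF C(1)])
  next
    fix x :: 'f assume "x \<noteq> 0"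
    then have "0 < av x" by simp
    then obtain P D where D: "D \<noteq> 0" and y: "av (x - emb (Fract P D)) < av x" by (rule approx)
    have "av (emb (Fract P D)) = av x" using y by (intro av_dominant) (simp add: av_commute[of _ x])
    then have x_eq: "av x = place_abs v P / place_abs v D" by (simp add: av_frac[OF D])
    have "P \<noteq> 0"
    proof
      assume "P = 0"
      then have "av x = 0" unfolding x_eq by (cases v) simp_all
      then show False using \<open>0 < av x\<close> by simp
    qed
    then obtain e e' where "place_abs v P = (1 / real Q) powi e" "place_abs v D = (1 / real Q) powi e'"
      using place_abs_powi[OF v] D unfolding Q_def d_def by metis
    then have "av x = av (emb (uniformizer v)) powi (e - e')"
      unfolding x_eq av_p using Q by (simp add: power_int_diff)
    then show "\<exists>e. av x = av (emb (uniformizer v)) powi e" by blast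
  qed
  then show ?thesis by (simp only: Q_def d_def)
qed

end

section \<open>Local measures of the quadric over the places of the rational function field\<close>

theorem proposition4p1:
  fixes q r :: nat
    and a :: "'k :: {field, finite} poly"
    and g :: "nat \<Rightarrow> 'k poly fract mpol"
    and v :: "'k poly place"
    and emb :: "'k poly fract \<Rightarrow> 'f :: field"
    and av :: "'f \<Rightarrow> real"
    and vol :: "nat \<Rightarrow> (nat \<Rightarrow> 'f) measure"
    and m :: "(nat \<Rightarrow> 'f) measure"
  assumes "q = CARD('k)" and "odd q" and "r \<ge> 4" and "a \<noteq> 0"
    and "gauge_form r (to_fract a) g"
    and "is_place v" and "place_completion v emb av"
    and "\<And>n. is_haar av n (vol n)"
    and "is_form_measure emb av r (X_points r (emb (to_fract a))) g (vol (r - 1)) m"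
  shows
    "(v \<noteq> Infinite_place \<longrightarrow>
        (let d = place_degree v; pv = emb (uniformizer v); b = emb (to_fract a);
             S = X_integral_points av r b
         in emeasure m S < \<infinity> \<and>
            (\<lambda>l. real (card (residue_solutions av pv r l l b)) / real q ^ (l * d * (r - 1)))
              \<longlonglongrightarrow> measure m S))
   \<and> (v = Infinite_place \<longrightarrow>
        (\<forall>n :: nat.
          let pv = emb (uniformizer v); b = emb (to_fract a);
              c = emb (to_fract a / tvar ^ (2 * n));
              S = X_bounded_points av r b (real q ^ n)
          in emeasure m S < \<infinity> \<and>
             (\<lambda>l. real q ^ (n * r + l) * measure (vol r) (cong_solutions av pv r (2 * n + l) c))
               \<longlonglongrightarrow> measure m S \<and>
             (\<forall>l. \<forall>\<^sub>F k in sequentially.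
                measure (vol r) (cong_solutions av pv r (2 * n + l) c)
                  = real (card (residue_solutions av pv r k (2 * n + l) c)) / real q ^ (k * r))))"
proof -
  interpret place_completion v emb av by fact
  define p where "p = emb (uniformizer v)"
  define d where "d = place_degree v"
  define b where "b = emb (to_fract a)"
  interpret odd_local_field av p "CARD('k) ^ d" "(\<lambda>P. emb (to_fract P)) ` polys_below d"
    using completion_is_local_field[OF assms(6)] assms(1,2) by (simp add: p_def d_def)
  have q: "0 < real q" by (simp add: assms(1))
  have Q: "real (CARD('k) ^ d) = real q ^ d" by (simp add: assms(1))
  have "av b = place_abs v a" unfolding b_def by (rule av_emb_poly[OF assms(6)])
  then have b0: "b \<noteq> 0" using place_abs_pos[OF assms(6,4)] by auto
  have r: "2 \<le> r" using assms(3) by simp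
  have form: "is_form_measure emb av r (X_points r b) g (vol (r - 1)) m"
    using assms(9) by (simp only: b_def)
  have gauge: "\<exists>\<epsilon>. (\<epsilon> = 1 \<or> \<epsilon> = - 1) \<and>
      (\<Sum>l<r. (- 1) ^ (r - 1 - l) * meval emb (g l) x * (2 * x l)) = \<epsilon>" if "x \<in> X_points r b" for x
  proof -
    have "quad r x = emb (to_fract a)" using that by (simp add: X_points_def b_def)
    from gauge_form_at_point[OF emb_add emb_mult emb_0 emb_one assms(5) this] show ?thesis by metis
  qed
  note volume = form_measure_eq_volume[OF r _ _ assms(8) assms(8) form gauge refl]
  \<comment> \<open>A finite place is the case \<open>n = 0\<close> of the comparison.\<close>
  have finite_place: "emeasure m (X_integral_points av r b) < \<infinity> \<and>
      (\<lambda>l. real (card (residue_solutions av p r l l b)) / real q ^ (l * d * (r - 1)))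
        \<longlonglongrightarrow> measure m (X_integral_points av r b)"
  proof -
    have S: "X_integral_points av r b = X_bounded_points av r b (1 / av p ^ 0)"
      by (rule Set.set_eqI)
         (auto simp only: X_integral_points_def X_bounded_points_def X_points_def integral_points_def
            integers_def PiE_iff mem_Collect_eq lessThan_iff UNIV_I power_0 div_by_1)
    have b_eq: "b = b / p ^ (2 * 0)" by simp
    obtain L where L: "\<And>l. L \<le> l \<Longrightarrow> (real q ^ d) ^ l * measure (vol r) (cong_solutions av p r l b)
        = measure m (X_integral_points av r b)"
      using volume(2)[OF b0 b_eq] unfolding S Q by (auto simp only: mult_0 mult_0_right add_0)
    have "real (card (residue_solutions av p r l l b)) / real q ^ (l * d * (r - 1))
        = (real q ^ d) ^ l * measure (vol r) (cong_solutions av p r l b)" for l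
    proof -
      obtain r' where r': "r = Suc r'" using r by (cases r) simp_all
      have "real q ^ (d * (l * r)) = real q ^ (d * l) * real q ^ (l * d * (r - 1))"
        unfolding power_add[symmetric] r' by (simp add: algebra_simps)
      then show ?thesis
        unfolding measure_cong_solutions[OF assms(8) order_refl] Q power_mult[symmetric]
        using q by (simp add: field_simps)
    qed
    then have "eventually (\<lambda>l. real (card (residue_solutions av p r l l b)) / real q ^ (l * d * (r - 1))
        = measure m (X_integral_points av r b)) sequentially"
      using L unfolding eventually_sequentially by (intro exI[of _ L]) simp
    then have "(\<lambda>l. real (card (residue_solutions av p r l l b)) / real q ^ (l * d * (r - 1)))
        \<longlonglongrightarrow> measure m (X_integral_points av r b)" by (rule tendsto_eventually)
    then show ?thesis using volume(1)[OF b0 b_eq] unfolding S by blast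
  qed
  have infinite_place: "emeasure m (X_bounded_points av r b (real q ^ n)) < \<infinity> \<and>
      (\<lambda>l. real q ^ (n * r + l) * measure (vol r) (cong_solutions av p r (2 * n + l) c))
        \<longlonglongrightarrow> measure m (X_bounded_points av r b (real q ^ n)) \<and>
      (\<forall>l. \<forall>\<^sub>F k in sequentially. measure (vol r) (cong_solutions av p r (2 * n + l) c)
        = real (card (residue_solutions av p r k (2 * n + l) c)) / real q ^ (k * r))"
    if v: "v = Infinite_place" and c: "c = emb (to_fract a / tvar ^ (2 * n))" for n c
  proof -
    have d1: "real q ^ d = real q" using v by (simp add: d_def)
    have p_eq: "p = inverse (emb tvar)" using v by (simp add: p_def emb_inverse)
    have c_eq: "c = b * p ^ (2 * n)"
      unfolding c b_def p_eq emb_divide emb_power power_inverse by (rule divide_inverse)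
    have c0: "c \<noteq> 0" using b0 by (simp add: c_eq)
    have b_eq: "b = c / p ^ (2 * n)" by (simp add: c_eq)
    have R: "1 / av p ^ n = real q ^ n"
      unfolding av_p Q d1 by (simp add: power_divide)
    obtain L where L: "\<And>l. L \<le> l \<Longrightarrow> real q ^ (n * r + l) * measure (vol r) (cong_solutions av p r (2 * n + l) c)
        = measure m (X_bounded_points av r b (real q ^ n))"
      using volume(2)[OF c0 b_eq] unfolding R Q d1 by blast
    have "eventually (\<lambda>l. real q ^ (n * r + l) * measure (vol r) (cong_solutions av p r (2 * n + l) c)
        = measure m (X_bounded_points av r b (real q ^ n))) sequentially"
      unfolding eventually_sequentially using L by blast
    then have "(\<lambda>l. real q ^ (n * r + l) * measure (vol r) (cong_solutions av p r (2 * n + l) c))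
        \<longlonglongrightarrow> measure m (X_bounded_points av r b (real q ^ n))" by (rule tendsto_eventually)
    moreover have "emeasure m (X_bounded_points av r b (real q ^ n)) < \<infinity>"
      using volume(1)[OF c0 b_eq] unfolding R .
    moreover have "\<forall>\<^sub>F k in sequentially. measure (vol r) (cong_solutions av p r (2 * n + l) c)
        = real (card (residue_solutions av p r k (2 * n + l) c)) / real q ^ (k * r)" for l
      unfolding eventually_sequentially
      using measure_cong_solutions[OF assms(8), of "2 * n + l" _ r c] unfolding Q d1 by blast
    ultimately show ?thesis by blast
  qed
  show ?thesis
    unfolding Let_def p_def[symmetric] d_def[symmetric] b_def[symmetric]
    using finite_place infinite_place by blast
qed

end
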